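(* When $\mathbb{E}$ is a Gumm category, so are the category $Grd\mathbb{E}$ of internal groupoids in $\mathbb{E}$ and the category $Cat\mathbb{E}$ of internal categories in $\mathbb{E}$.
   Context: A Gumm category is a finitely complete category satisfying the Shifting Lemma: for any equivalence relations $R,S,T$ on an object $X$ with $R\cap S\subset T$ and any generalized elements $x,y,x',y'$ of $X$ with $xSy$, $x'Sy'$, $xRx'$, $yRy'$, if $xTx'$ then $yTy'$. The morphisms of $Grd\mathbb{E}$ and $Cat\mathbb{E}$ are the internal functors. *)

theory Defs
  imports Main
begin

section \<open>Categories and finite limits\<close>

record ('o, 'm) cat =
  Ob :: "'o set"
  Mor :: "'m set"
  Dom :: "'m \<Rightarrow> 'o"
  Cod :: "'m \<Rightarrow> 'o"
  Idn :: "'o \<Rightarrow> 'm"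
  Cmp :: "'m \<Rightarrow> 'm \<Rightarrow> 'm" (infixl \<open>\<cdot>\<index>\<close> 70)

definition Hom :: "('o, 'm) cat \<Rightarrow> 'o \<Rightarrow> 'o \<Rightarrow> 'm set" where
  "Hom C A B = {f \<in> Mor C. Dom C f = A \<and> Cod C f = B}"

text \<open>Composition is in the usual order: \<open>g \<cdot> f\<close> is meaningful when \<open>Cod f = Dom g\<close>.\<close>

locale category =
  fixes C :: "('o, 'm) cat" (structure)
  assumes Dom_in_Ob: "f \<in> Mor C \<Longrightarrow> Dom C f \<in> Ob C"
    and Cod_in_Ob: "f \<in> Mor C \<Longrightarrow> Cod C f \<in> Ob C"
    and Idn_in_Hom: "A \<in> Ob C \<Longrightarrow> Idn C A \<in> Hom C A A"
    and Cmp_in_Hom: "f \<in> Hom C A B \<Longrightarrow> g \<in> Hom C B D \<Longrightarrow> g \<cdot> f \<in> Hom C A D"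
    and Cmp_Idn_left: "f \<in> Hom C A B \<Longrightarrow> Idn C B \<cdot> f = f"
    and Cmp_Idn_right: "f \<in> Hom C A B \<Longrightarrow> f \<cdot> Idn C A = f"
    and Cmp_assoc: "f \<in> Hom C A B \<Longrightarrow> g \<in> Hom C B D \<Longrightarrow> h \<in> Hom C D E \<Longrightarrow>
      (h \<cdot> g) \<cdot> f = h \<cdot> (g \<cdot> f)"

definition cat_functor ::
  "('i, 'j) cat \<Rightarrow> ('o, 'm) cat \<Rightarrow> ('i \<Rightarrow> 'o) \<Rightarrow> ('j \<Rightarrow> 'm) \<Rightarrow> bool" where
  "cat_functor J C D\<^sub>0 D\<^sub>1 \<longleftrightarrow>
     (\<forall>i\<in>Ob J. D\<^sub>0 i \<in> Ob C) \<and>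
     (\<forall>a\<in>Mor J. D\<^sub>1 a \<in> Hom C (D\<^sub>0 (Dom J a)) (D\<^sub>0 (Cod J a))) \<and>
     (\<forall>i\<in>Ob J. D\<^sub>1 (Idn J i) = Idn C (D\<^sub>0 i)) \<and>
     (\<forall>a\<in>Mor J. \<forall>b\<in>Mor J. Cod J a = Dom J b \<longrightarrow> D\<^sub>1 (b \<cdot>\<^bsub>J\<^esub> a) = D\<^sub>1 b \<cdot>\<^bsub>C\<^esub> D\<^sub>1 a)"

definition is_cone ::
  "('i, 'j) cat \<Rightarrow> ('o, 'm) cat \<Rightarrow> ('i \<Rightarrow> 'o) \<Rightarrow> ('j \<Rightarrow> 'm) \<Rightarrow> 'o \<Rightarrow> ('i \<Rightarrow> 'm) \<Rightarrow> bool" where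
  "is_cone J C D\<^sub>0 D\<^sub>1 L l \<longleftrightarrow>
     L \<in> Ob C \<and>
     (\<forall>i\<in>Ob J. l i \<in> Hom C L (D\<^sub>0 i)) \<and>
     (\<forall>a\<in>Mor J. D\<^sub>1 a \<cdot>\<^bsub>C\<^esub> l (Dom J a) = l (Cod J a))"

definition is_limit ::
  "('i, 'j) cat \<Rightarrow> ('o, 'm) cat \<Rightarrow> ('i \<Rightarrow> 'o) \<Rightarrow> ('j \<Rightarrow> 'm) \<Rightarrow> 'o \<Rightarrow> ('i \<Rightarrow> 'm) \<Rightarrow> bool" where
  "is_limit J C D\<^sub>0 D\<^sub>1 L l \<longleftrightarrow>
     is_cone J C D\<^sub>0 D\<^sub>1 L l \<and>
     (\<forall>U u. is_cone J C D\<^sub>0 D\<^sub>1 U u \<longrightarrow>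
        (\<exists>!h. h \<in> Hom C U L \<and> (\<forall>i\<in>Ob J. l i \<cdot>\<^bsub>C\<^esub> h = u i)))"

text \<open>Every finite category is isomorphic to one whose objects and morphisms are natural
  numbers, so index categories of type \<open>(nat, nat) cat\<close> cover all finite diagrams.\<close>

definition finitely_complete :: "('o, 'm) cat \<Rightarrow> bool" where
  "finitely_complete C \<longleftrightarrow>
     (\<forall>(J :: (nat, nat) cat) D\<^sub>0 D\<^sub>1.
        category J \<and> finite (Ob J) \<and> finite (Mor J) \<and> cat_functor J C D\<^sub>0 D\<^sub>1 \<longrightarrow>
        (\<exists>L l. is_limit J C D\<^sub>0 D\<^sub>1 L l))"

text \<open>\<open>is_pullback C P p q f g\<close>: the square \<open>f \<cdot> p = g \<cdot> q\<close> with vertex \<open>P\<close> is a pullback.\<close>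

definition is_pullback ::
  "('o, 'm) cat \<Rightarrow> 'o \<Rightarrow> 'm \<Rightarrow> 'm \<Rightarrow> 'm \<Rightarrow> 'm \<Rightarrow> bool" where
  "is_pullback C P p q f g \<longleftrightarrow>
     f \<in> Mor C \<and> g \<in> Mor C \<and> Cod C f = Cod C g \<and>
     p \<in> Hom C P (Dom C f) \<and> q \<in> Hom C P (Dom C g) \<and>
     f \<cdot>\<^bsub>C\<^esub> p = g \<cdot>\<^bsub>C\<^esub> q \<and>
     (\<forall>U\<in>Ob C. \<forall>u\<in>Hom C U (Dom C f). \<forall>v\<in>Hom C U (Dom C g).
        f \<cdot>\<^bsub>C\<^esub> u = g \<cdot>\<^bsub>C\<^esub> v \<longrightarrow>
        (\<exists>!h. h \<in> Hom C U P \<and> p \<cdot>\<^bsub>C\<^esub> h = u \<and> q \<cdot>\<^bsub>C\<^esub> h = v))"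


section \<open>Internal relations and Gumm categories\<close>

text \<open>A relation on \<open>X\<close>, i.e. a subobject of \<open>X \<times> X\<close>, is given by a jointly monic pair
  \<open>(r\<^sub>0, r\<^sub>1)\<close> of parallel morphisms into \<open>X\<close>; its underlying object is the common domain.\<close>

definition is_relation :: "('o, 'm) cat \<Rightarrow> 'o \<Rightarrow> 'm \<times> 'm \<Rightarrow> bool" where
  "is_relation C X R \<longleftrightarrow>
     X \<in> Ob C \<and>
     (\<exists>R\<^sub>0\<in>Ob C. fst R \<in> Hom C R\<^sub>0 X \<and> snd R \<in> Hom C R\<^sub>0 X \<and>
        (\<forall>U\<in>Ob C. \<forall>u\<in>Hom C U R\<^sub>0. \<forall>v\<in>Hom C U R\<^sub>0.
           fst R \<cdot>\<^bsub>C\<^esub> u = fst R \<cdot>\<^bsub>C\<^esub> v \<and> snd R \<cdot>\<^bsub>C\<^esub> u = snd R \<cdot>\<^bsub>C\<^esub> v \<longrightarrow> u = v))"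

text \<open>\<open>rel_holds C R x y\<close> is \<open>x R y\<close> for generalized elements \<open>x, y : U \<rightarrow> X\<close>: the pair
  \<open>(x, y)\<close> factors through \<open>R\<close>.\<close>

definition rel_holds :: "('o, 'm) cat \<Rightarrow> 'm \<times> 'm \<Rightarrow> 'm \<Rightarrow> 'm \<Rightarrow> bool" where
  "rel_holds C R x y \<longleftrightarrow>
     (\<exists>h\<in>Mor C. Cod C h = Dom C (fst R) \<and> fst R \<cdot>\<^bsub>C\<^esub> h = x \<and> snd R \<cdot>\<^bsub>C\<^esub> h = y)"

definition rel_le :: "('o, 'm) cat \<Rightarrow> 'm \<times> 'm \<Rightarrow> 'm \<times> 'm \<Rightarrow> bool" where
  "rel_le C V W \<longleftrightarrow>
     (\<exists>h\<in>Hom C (Dom C (fst V)) (Dom C (fst W)).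
        fst W \<cdot>\<^bsub>C\<^esub> h = fst V \<and> snd W \<cdot>\<^bsub>C\<^esub> h = snd V)"

text \<open>The intersection of two relations is their infimum among the relations on \<open>X\<close>; as a
  subobject it is determined up to isomorphism.\<close>

definition is_intersection ::
  "('o, 'm) cat \<Rightarrow> 'o \<Rightarrow> 'm \<times> 'm \<Rightarrow> 'm \<times> 'm \<Rightarrow> 'm \<times> 'm \<Rightarrow> bool" where
  "is_intersection C X W R S \<longleftrightarrow>
     is_relation C X W \<and> rel_le C W R \<and> rel_le C W S \<and>
     (\<forall>V. is_relation C X V \<and> rel_le C V R \<and> rel_le C V S \<longrightarrow> rel_le C V W)"

definition is_equivalence_relation :: "('o, 'm) cat \<Rightarrow> 'o \<Rightarrow> 'm \<times> 'm \<Rightarrow> bool" where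
  "is_equivalence_relation C X R \<longleftrightarrow>
     is_relation C X R \<and>
     (\<forall>U\<in>Ob C. equiv (Hom C U X) {(x, y) \<in> Hom C U X \<times> Hom C U X. rel_holds C R x y})"

definition shifting_lemma :: "('o, 'm) cat \<Rightarrow> bool" where
  "shifting_lemma C \<longleftrightarrow>
     (\<forall>X R S T W.
        is_equivalence_relation C X R \<and> is_equivalence_relation C X S \<and>
        is_equivalence_relation C X T \<and>
        is_intersection C X W R S \<and> rel_le C W T \<longrightarrow>
        (\<forall>U\<in>Ob C. \<forall>x\<in>Hom C U X. \<forall>y\<in>Hom C U X. \<forall>x'\<in>Hom C U X. \<forall>y'\<in>Hom C U X.
           rel_holds C S x y \<and> rel_holds C S x' y' \<and>
           rel_holds C R x x' \<and> rel_holds C R y y' \<and>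
           rel_holds C T x x' \<longrightarrow> rel_holds C T y y'))"

definition gumm_category :: "('o, 'm) cat \<Rightarrow> bool" where
  "gumm_category C \<longleftrightarrow> category C \<and> finitely_complete C \<and> shifting_lemma C"


section \<open>Internal categories and groupoids\<close>

text \<open>The object \<open>X2\<close> of composable pairs, a pullback of \<open>src\<close> along \<open>tgt\<close>, is part of the data.
  Thinking of an element of \<open>X2\<close> as \<open>(g, f)\<close> with \<open>src g = tgt f\<close>, the projections \<open>prl\<close>, \<open>prr\<close>
  return \<open>g\<close>, \<open>f\<close>, and \<open>mult\<close> returns the composite of \<open>f\<close> followed by \<open>g\<close>.\<close>

record ('o, 'm) icat =
  X0 :: 'o
  X1 :: 'o
  X2 :: 'o
  src :: 'm
  tgt :: 'm
  unt :: 'm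
  prl :: 'm
  prr :: 'm
  mult :: 'm

definition ipair :: "('o, 'm) cat \<Rightarrow> ('o, 'm) icat \<Rightarrow> 'm \<Rightarrow> 'm \<Rightarrow> 'm" where
  "ipair \<E> X g f =
     (THE h. h \<in> Hom \<E> (Dom \<E> f) (X2 X) \<and> prl X \<cdot>\<^bsub>\<E>\<^esub> h = g \<and> prr X \<cdot>\<^bsub>\<E>\<^esub> h = f)"

text \<open>In the associativity axiom, \<open>X3\<close> with \<open>u = (h, g)\<close> and \<open>v = (g, f)\<close> is any object of
  composable triples \<open>(h, g, f)\<close>.\<close>

locale internal_category =
  fixes \<E> :: "('o, 'm) cat" (structure) and X :: "('o, 'm) icat"
  assumes X0_in_Ob: "X0 X \<in> Ob \<E>"
    and X1_in_Ob: "X1 X \<in> Ob \<E>"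
    and X2_in_Ob: "X2 X \<in> Ob \<E>"
    and src_in_Hom: "src X \<in> Hom \<E> (X1 X) (X0 X)"
    and tgt_in_Hom: "tgt X \<in> Hom \<E> (X1 X) (X0 X)"
    and unt_in_Hom: "unt X \<in> Hom \<E> (X0 X) (X1 X)"
    and mult_in_Hom: "mult X \<in> Hom \<E> (X2 X) (X1 X)"
    and X2_pullback: "is_pullback \<E> (X2 X) (prl X) (prr X) (src X) (tgt X)"
    and src_unt: "src X \<cdot> unt X = Idn \<E> (X0 X)"
    and tgt_unt: "tgt X \<cdot> unt X = Idn \<E> (X0 X)"
    and src_mult: "src X \<cdot> mult X = src X \<cdot> prr X"
    and tgt_mult: "tgt X \<cdot> mult X = tgt X \<cdot> prl X"
    and mult_unt_right: "mult X \<cdot> ipair \<E> X (Idn \<E> (X1 X)) (unt X \<cdot> src X) = Idn \<E> (X1 X)"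
    and mult_unt_left: "mult X \<cdot> ipair \<E> X (unt X \<cdot> tgt X) (Idn \<E> (X1 X)) = Idn \<E> (X1 X)"
    and mult_assoc: "is_pullback \<E> X3 u v (prr X) (prl X) \<Longrightarrow>
      mult X \<cdot> ipair \<E> X (mult X \<cdot> u) (prr X \<cdot> v) =
      mult X \<cdot> ipair \<E> X (prl X \<cdot> u) (mult X \<cdot> v)"

text \<open>Inversion is unique when it exists and is preserved by every internal functor, so being a
  groupoid is a property of an internal category.\<close>

definition internal_groupoid :: "('o, 'm) cat \<Rightarrow> ('o, 'm) icat \<Rightarrow> bool" where
  "internal_groupoid \<E> X \<longleftrightarrow>
     internal_category \<E> X \<and>
     (\<exists>i\<in>Hom \<E> (X1 X) (X1 X).
        src X \<cdot>\<^bsub>\<E>\<^esub> i = tgt X \<and> tgt X \<cdot>\<^bsub>\<E>\<^esub> i = src X \<and>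
        mult X \<cdot>\<^bsub>\<E>\<^esub> ipair \<E> X i (Idn \<E> (X1 X)) = unt X \<cdot>\<^bsub>\<E>\<^esub> src X \<and>
        mult X \<cdot>\<^bsub>\<E>\<^esub> ipair \<E> X (Idn \<E> (X1 X)) i = unt X \<cdot>\<^bsub>\<E>\<^esub> tgt X)"

record ('o, 'm) ifun =
  fdom :: "('o, 'm) icat"
  fcod :: "('o, 'm) icat"
  F0 :: 'm
  F1 :: 'm

definition internal_functor :: "('o, 'm) cat \<Rightarrow> ('o, 'm) ifun \<Rightarrow> bool" where
  "internal_functor \<E> F \<longleftrightarrow>
     (let X = fdom F; Y = fcod F in
        internal_category \<E> X \<and> internal_category \<E> Y \<and>
        F0 F \<in> Hom \<E> (X0 X) (X0 Y) \<and> F1 F \<in> Hom \<E> (X1 X) (X1 Y) \<and>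
        src Y \<cdot>\<^bsub>\<E>\<^esub> F1 F = F0 F \<cdot>\<^bsub>\<E>\<^esub> src X \<and>
        tgt Y \<cdot>\<^bsub>\<E>\<^esub> F1 F = F0 F \<cdot>\<^bsub>\<E>\<^esub> tgt X \<and>
        F1 F \<cdot>\<^bsub>\<E>\<^esub> unt X = unt Y \<cdot>\<^bsub>\<E>\<^esub> F0 F \<and>
        F1 F \<cdot>\<^bsub>\<E>\<^esub> mult X =
          mult Y \<cdot>\<^bsub>\<E>\<^esub> ipair \<E> Y (F1 F \<cdot>\<^bsub>\<E>\<^esub> prl X) (F1 F \<cdot>\<^bsub>\<E>\<^esub> prr X))"

definition Cat :: "('o, 'm) cat \<Rightarrow> (('o, 'm) icat, ('o, 'm) ifun) cat" where
  "Cat \<E> =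
     \<lparr>Ob = {X. internal_category \<E> X},
      Mor = {F. internal_functor \<E> F},
      Dom = fdom,
      Cod = fcod,
      Idn = (\<lambda>X. \<lparr>fdom = X, fcod = X, F0 = Idn \<E> (X0 X), F1 = Idn \<E> (X1 X)\<rparr>),
      Cmp = (\<lambda>G F. \<lparr>fdom = fdom F, fcod = fcod G,
                     F0 = F0 G \<cdot>\<^bsub>\<E>\<^esub> F0 F, F1 = F1 G \<cdot>\<^bsub>\<E>\<^esub> F1 F\<rparr>)\<rparr>"

definition Grd :: "('o, 'm) cat \<Rightarrow> (('o, 'm) icat, ('o, 'm) ifun) cat" where
  "Grd \<E> = (Cat \<E>)
     \<lparr>Ob := {X. internal_groupoid \<E> X},
      Mor := {F. internal_functor \<E> F \<and>
                 internal_groupoid \<E> (fdom F) \<and> internal_groupoid \<E> (fcod F)}\<rparr>"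

end

theory Submission
  imports Defs
begin

text \<open>Finite limits of internal categories are computed levelwise in \<open>\<E>\<close>, on objects and on arrows,
  and a levelwise limit of groupoids is a groupoid because internal functors preserve inverses.
  Hence both level functors preserve jointly monic pairs, equivalence relations and their
  intersections, so the Shifting Lemma can be applied in \<open>\<E>\<close> at each level. This yields morphisms
  of \<open>\<E>\<close> on objects and on arrows through which the two levels of \<open>(y, y')\<close> factor; since
  \<open>T\<close> is jointly monic at both levels, they automatically form an internal functor, so \<open>y T y'\<close>.\<close>

section \<open>Finite limits\<close>

text \<open>Generalized elements are the obstacle: an equivalence relation in
  \<open>Cat \<E>\<close> is tested only on objects of \<open>Cat \<E>\<close>, whereas its levels
  must be tested on all objects of \<E>. Each notion in the hypotheses is therefore rewritten
  through equations and a finite limit: joint monicity as equality of the two legs of a joint kernel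
  pair, an equivalence relation as morphisms for reflexivity, symmetry and transitivity, an
  intersection as a limit. These forms are stable under every functor preserving the limits in
  question, so the transfer is carried out for an abstract family of functors. Inside \<E> the
  passage goes the other way: units, associativity and functoriality are stated for particular
  pairings and pullbacks, and become usable once known for all generalized elements. Only two levels
  need to be followed, because composable pairs are a pullback of these. \<open>Cat \<E>\<close> and
  \<open>Grd \<E>\<close> are handled together as full subcategories cut out by a predicate closed
  under levelwise limits.\<close>

context category
begin

lemma Dom_Cmp:
  "f \<in> Mor C \<Longrightarrow> g \<in> Mor C \<Longrightarrow> Cod C f = Dom C g \<Longrightarrow> Dom C (g \<cdot> f) = Dom C f"
  using Cmp_in_Hom[of f "Dom C f" "Cod C f" g "Cod C g"] by (auto simp: Hom_def)

lemma Hom_Ob: "f \<in> Hom C A B \<Longrightarrow> A \<in> Ob C \<and> B \<in> Ob C"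
  using Dom_in_Ob Cod_in_Ob by (auto simp: Hom_def)

text \<open>A commuting square is read at a generalized element \<open>k\<close>. Most later
  calculations use the equations of \<E> in this right-nested form, or in the form of the next
  lemma, where one side is a single morphism.\<close>

lemma Cmp_eq_Cmp:
  assumes "a \<cdot> b = c \<cdot> d" "k \<in> Hom C U V" "b \<in> Hom C V A" "a \<in> Hom C A B"
    "d \<in> Hom C V A'" "c \<in> Hom C A' B'"
  shows "a \<cdot> (b \<cdot> k) = c \<cdot> (d \<cdot> k)"
  using Cmp_assoc[OF assms(2-4)] Cmp_assoc[OF assms(2,5,6)] assms(1) by simp

lemma Cmp_eq_single:
  assumes "a \<cdot> b = c" "k \<in> Hom C U V" "b \<in> Hom C V A" "a \<in> Hom C A B"
  shows "a \<cdot> (b \<cdot> k) = c \<cdot> k"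
  using Cmp_assoc[OF assms(2-4)] assms(1) by simp

text \<open>Both \<open>h\<close> and \<open>k\<close> mediate the cone
  \<open>l i \<cdot> h\<close>, and mediating morphisms are unique.\<close>

lemma limit_joint_mono:
  assumes lim: "is_limit J C D\<^sub>0 D\<^sub>1 L l" and "category J" and D: "cat_functor J C D\<^sub>0 D\<^sub>1"
    and h: "h \<in> Hom C U L" and k: "k \<in> Hom C U L"
    and eq: "\<And>i. i \<in> Ob J \<Longrightarrow> l i \<cdot> h = l i \<cdot> k"
  shows "h = k"
proof -
  interpret J: category J by fact
  have l: "l i \<in> Hom C L (D\<^sub>0 i)" if "i \<in> Ob J" for i
    using lim that by (auto simp: is_limit_def is_cone_def)
  have "is_cone J C D\<^sub>0 D\<^sub>1 U (\<lambda>i. l i \<cdot> h)"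
    unfolding is_cone_def
  proof (intro conjI ballI)
    show "U \<in> Ob C" using h Hom_Ob by blast
    show "l i \<cdot> h \<in> Hom C U (D\<^sub>0 i)" if "i \<in> Ob J" for i
      using l[OF that] h Cmp_in_Hom by blast
    fix a assume a: "a \<in> Mor J"
    have "D\<^sub>1 a \<in> Hom C (D\<^sub>0 (Dom J a)) (D\<^sub>0 (Cod J a))" using D a by (auto simp: cat_functor_def)
    moreover have "D\<^sub>1 a \<cdot> l (Dom J a) = l (Cod J a)"
      using lim a by (auto simp: is_limit_def is_cone_def)
    ultimately show "D\<^sub>1 a \<cdot> (l (Dom J a) \<cdot> h) = l (Cod J a) \<cdot> h"
      using Cmp_eq_single[OF _ h l[OF J.Dom_in_Ob[OF a]]] by blast
  qed
  then have "\<exists>!m. m \<in> Hom C U L \<and> (\<forall>i\<in>Ob J. l i \<cdot> m = l i \<cdot> h)"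
    using lim by (auto simp: is_limit_def)
  then show ?thesis using h k eq by metis
qed

end

lemma limit_factor:
  assumes "is_limit J C D\<^sub>0 D\<^sub>1 L l" "U \<in> Ob C"
    and "\<And>i. i \<in> Ob J \<Longrightarrow> u i \<in> Hom C U (D\<^sub>0 i)"
    and "\<And>a. a \<in> Mor J \<Longrightarrow> D\<^sub>1 a \<cdot>\<^bsub>C\<^esub> u (Dom J a) = u (Cod J a)"
  obtains h where "h \<in> Hom C U L" "\<And>i. i \<in> Ob J \<Longrightarrow> l i \<cdot>\<^bsub>C\<^esub> h = u i"
proof -
  have "is_cone J C D\<^sub>0 D\<^sub>1 U u" using assms(2-4) by (auto simp: is_cone_def)
  then show thesis using assms(1) that unfolding is_limit_def by blast
qed

lemma limit_cone:
  assumes "is_limit J C D\<^sub>0 D\<^sub>1 L l"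
  shows "L \<in> Ob C" "i \<in> Ob J \<Longrightarrow> l i \<in> Hom C L (D\<^sub>0 i)"
    "a \<in> Mor J \<Longrightarrow> D\<^sub>1 a \<cdot>\<^bsub>C\<^esub> l (Dom J a) = l (Cod J a)"
  using assms by (auto simp: is_limit_def is_cone_def)

text \<open>The free category on the graph with edges \<open>4 : 0 \<rightarrow> 2\<close>, \<open>5 : 0 \<rightarrow> 3\<close>, \<open>6 : 1 \<rightarrow> 2\<close> and
  \<open>7 : 1 \<rightarrow> 3\<close>; the morphisms \<open>0, \<dots>, 3\<close> are the identities.\<close>

definition kite :: "(nat, nat) cat" where
  "kite = \<lparr>Ob = {..<4}, Mor = {..<8},
     Dom = (\<lambda>m. if m < 4 then m else if m < 6 then 0 else 1),
     Cod = (\<lambda>m. if m < 4 then m else if even m then 2 else 3),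
     Idn = (\<lambda>i. i), Cmp = (\<lambda>g f. if f < 4 then g else f)\<rparr>"

lemma less_4_iff: "i < 4 \<longleftrightarrow> i = 0 \<or> i = 1 \<or> i = 2 \<or> i = (3::nat)" by auto

lemma kite_Hom: "f \<in> Hom kite A B \<longleftrightarrow>
    f < 8 \<and> (if f < 4 then A = f \<and> B = f
      else A = (if f < 6 then 0 else 1) \<and> B = (if even f then 2 else 3))"
  by (auto simp: kite_def Hom_def)

lemma category_kite: "category kite"
proof
  show "g \<cdot>\<^bsub>kite\<^esub> f \<in> Hom kite A D" if "f \<in> Hom kite A B" "g \<in> Hom kite B D" for f g A B D
    using that unfolding kite_Hom by (auto simp: kite_def split: if_splits)
  show "Dom kite f \<in> Ob kite" "Cod kite f \<in> Ob kite" if "f \<in> Mor kite" for f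
    using that by (simp_all add: kite_def)
  show "Idn kite A \<in> Hom kite A A" if "A \<in> Ob kite" for A
    using that unfolding kite_Hom by (simp add: kite_def)
  show "Idn kite B \<cdot>\<^bsub>kite\<^esub> f = f" if "f \<in> Hom kite A B" for f A B
    using that unfolding kite_Hom by (simp add: kite_def split: if_splits)
  show "f \<cdot>\<^bsub>kite\<^esub> Idn kite A = f" if "f \<in> Hom kite A B" for f A B
    using that unfolding kite_Hom by (simp add: kite_def split: if_splits)
  show "(h \<cdot>\<^bsub>kite\<^esub> g) \<cdot>\<^bsub>kite\<^esub> f = h \<cdot>\<^bsub>kite\<^esub> (g \<cdot>\<^bsub>kite\<^esub> f)" for f g h
    by (simp add: kite_def)
qed

text \<open>One shape for three purposes: pullbacks (\<open>r\<^sub>0 = r\<^sub>1\<close>, \<open>s\<^sub>0 = s\<^sub>1\<close>), intersections of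
  relations, and joint kernel pairs (\<open>r = s\<close>), which detect joint monicity.\<close>

definition is_double_pullback ::
  "('o, 'm) cat \<Rightarrow> 'o \<Rightarrow> 'm \<Rightarrow> 'm \<Rightarrow> 'm \<times> 'm \<Rightarrow> 'm \<times> 'm \<Rightarrow> bool" where
  "is_double_pullback C P p q r s \<longleftrightarrow>
     p \<in> Hom C P (Dom C (fst r)) \<and> q \<in> Hom C P (Dom C (fst s)) \<and>
     fst r \<cdot>\<^bsub>C\<^esub> p = fst s \<cdot>\<^bsub>C\<^esub> q \<and> snd r \<cdot>\<^bsub>C\<^esub> p = snd s \<cdot>\<^bsub>C\<^esub> q \<and>
     (\<forall>U\<in>Ob C. \<forall>u\<in>Hom C U (Dom C (fst r)). \<forall>v\<in>Hom C U (Dom C (fst s)).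
        fst r \<cdot>\<^bsub>C\<^esub> u = fst s \<cdot>\<^bsub>C\<^esub> v \<and> snd r \<cdot>\<^bsub>C\<^esub> u = snd s \<cdot>\<^bsub>C\<^esub> v \<longrightarrow>
        (\<exists>!h. h \<in> Hom C U P \<and> p \<cdot>\<^bsub>C\<^esub> h = u \<and> q \<cdot>\<^bsub>C\<^esub> h = v))"

context category
begin

text \<open>A cone over the kite is determined by its components at the sources 0 and 1; the
  components at the sinks 2 and 3 are composites with the edges, and their double description gives
  the two equations of a double pullback.\<close>

lemma limit_kite:
  assumes lim: "is_limit kite C D\<^sub>0 D\<^sub>1 L l" and D: "cat_functor kite C D\<^sub>0 D\<^sub>1"
  shows "is_double_pullback C L (l 0) (l 1) (D\<^sub>1 4, D\<^sub>1 5) (D\<^sub>1 6, D\<^sub>1 7)"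
proof -
  have D1: "D\<^sub>1 a \<in> Hom C (D\<^sub>0 (Dom kite a)) (D\<^sub>0 (Cod kite a))" if "a < 8" for a
    using D that by (simp add: cat_functor_def kite_def)
  have D1: "D\<^sub>1 4 \<in> Hom C (D\<^sub>0 0) (D\<^sub>0 2)" "D\<^sub>1 5 \<in> Hom C (D\<^sub>0 0) (D\<^sub>0 3)"
    "D\<^sub>1 6 \<in> Hom C (D\<^sub>0 1) (D\<^sub>0 2)" "D\<^sub>1 7 \<in> Hom C (D\<^sub>0 1) (D\<^sub>0 3)"
    using D1[of 4] D1[of 5] D1[of 6] D1[of 7] by (simp_all add: kite_def)
  have Id: "D\<^sub>1 i = Idn C (D\<^sub>0 i)" if "i < 4" for i
    using D that by (simp add: cat_functor_def kite_def)
  have l: "l i \<in> Hom C L (D\<^sub>0 i)" if "i < 4" for i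
    using limit_cone(2)[OF lim, of i] that by (simp add: kite_def)
  have l_eq: "D\<^sub>1 4 \<cdot> l 0 = l 2" "D\<^sub>1 5 \<cdot> l 0 = l 3" "D\<^sub>1 6 \<cdot> l 1 = l 2" "D\<^sub>1 7 \<cdot> l 1 = l 3"
    using limit_cone(3)[OF lim, of 4] limit_cone(3)[OF lim, of 5]
      limit_cone(3)[OF lim, of 6] limit_cone(3)[OF lim, of 7] by (simp_all add: kite_def)
  have uniq: "\<exists>!h. h \<in> Hom C U L \<and> l 0 \<cdot> h = u \<and> l 1 \<cdot> h = v"
    if u: "u \<in> Hom C U (D\<^sub>0 0)" and v: "v \<in> Hom C U (D\<^sub>0 1)"
      and eq: "D\<^sub>1 4 \<cdot> u = D\<^sub>1 6 \<cdot> v" "D\<^sub>1 5 \<cdot> u = D\<^sub>1 7 \<cdot> v" for U u v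
  proof -
    \<comment> \<open>The only possible cone extending \<open>u\<close> and \<open>v\<close>. The
      values at 2 and 3 are computed along the edges out of 0; \<open>eq\<close> says that the edges
      out of 1 give the same.\<close>
    define w where "w = (\<lambda>i::nat. if i = 0 then u else if i = 1 then v
      else if i = 2 then D\<^sub>1 4 \<cdot> u else D\<^sub>1 5 \<cdot> u)"
    have w: "w i \<in> Hom C U (D\<^sub>0 i)" if "i < 4" for i
      using that u v D1 Cmp_in_Hom unfolding less_4_iff w_def by auto
    obtain h where h: "h \<in> Hom C U L" and hw: "\<And>i. i \<in> Ob kite \<Longrightarrow> l i \<cdot> h = w i"
    proof (rule limit_factor[OF lim, of U w])
      show "U \<in> Ob C" using Hom_Ob[OF u] by simp
      show "w i \<in> Hom C U (D\<^sub>0 i)" if "i \<in> Ob kite" for i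
        using w that by (simp add: kite_def)
      show "D\<^sub>1 a \<cdot> w (Dom kite a) = w (Cod kite a)" if "a \<in> Mor kite" for a
      proof (cases "a < 4")
        case True
        then show ?thesis using w[OF True] Id[OF True] Cmp_Idn_left by (auto simp: kite_def)
      next
        case False
        then have "a = 4 \<or> a = 5 \<or> a = 6 \<or> a = 7" using that by (auto simp: kite_def)
        then show ?thesis using eq by (auto simp: kite_def w_def)
      qed
    qed auto
    show ?thesis
    proof (rule ex1I[of _ h])
      show "h \<in> Hom C U L \<and> l 0 \<cdot> h = u \<and> l 1 \<cdot> h = v"
        using h hw[of 0] hw[of 1] by (simp add: kite_def w_def)
      fix k assume k: "k \<in> Hom C U L \<and> l 0 \<cdot> k = u \<and> l 1 \<cdot> k = v"
      show "k = h"
      proof (rule limit_joint_mono[OF lim category_kite D, of _ U])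
        fix i assume "i \<in> Ob kite"
        then have "i < 4" by (simp add: kite_def)
        moreover have "l 0 \<cdot> k = l 0 \<cdot> h" "l 1 \<cdot> k = l 1 \<cdot> h"
          using k hw[of 0] hw[of 1] by (auto simp: kite_def w_def)
        moreover have "l 2 \<cdot> k = D\<^sub>1 4 \<cdot> (l 0 \<cdot> k)" "l 2 \<cdot> h = D\<^sub>1 4 \<cdot> (l 0 \<cdot> h)"
          "l 3 \<cdot> k = D\<^sub>1 5 \<cdot> (l 0 \<cdot> k)" "l 3 \<cdot> h = D\<^sub>1 5 \<cdot> (l 0 \<cdot> h)"
          using l_eq k h Cmp_assoc[OF _ l[of 0] D1(1)] Cmp_assoc[OF _ l[of 0] D1(2)] by auto
        ultimately show "l i \<cdot> k = l i \<cdot> h" unfolding less_4_iff by auto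
      qed (use h k in auto)
    qed
  qed
  have "Dom C (D\<^sub>1 4) = D\<^sub>0 0" "Dom C (D\<^sub>1 6) = D\<^sub>0 1" using D1 by (auto simp: Hom_def)
  then show ?thesis
    unfolding is_double_pullback_def using l[of 0] l[of 1] l_eq uniq by simp
qed

text \<open>In the kite no two edges are composable, so any choice of four morphisms with matching
  ends extends to a functor; both sinks are sent to \<open>X\<close>.\<close>

lemma cat_functor_kite:
  assumes r: "r\<^sub>0 \<in> Hom C A X" "r\<^sub>1 \<in> Hom C A X" and s: "s\<^sub>0 \<in> Hom C B X" "s\<^sub>1 \<in> Hom C B X"
  obtains D\<^sub>0 D\<^sub>1 where "cat_functor kite C D\<^sub>0 D\<^sub>1"
    "D\<^sub>1 4 = r\<^sub>0" "D\<^sub>1 5 = r\<^sub>1" "D\<^sub>1 6 = s\<^sub>0" "D\<^sub>1 7 = s\<^sub>1"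
proof -
  define D\<^sub>0 where "D\<^sub>0 = (\<lambda>i::nat. if i = 0 then A else if i = 1 then B else X)"
  define D\<^sub>1 where "D\<^sub>1 = (\<lambda>a::nat. if a < 4 then Idn C (D\<^sub>0 a) else if a = 4 then r\<^sub>0
    else if a = 5 then r\<^sub>1 else if a = 6 then s\<^sub>0 else s\<^sub>1)"
  have Ob: "D\<^sub>0 i \<in> Ob C" for i using Hom_Ob r s by (auto simp: D\<^sub>0_def)
  have Mor: "D\<^sub>1 a \<in> Hom C (D\<^sub>0 (Dom kite a)) (D\<^sub>0 (Cod kite a))" if "a < 8" for a
  proof (cases "a < 4")
    case True
    then show ?thesis using Ob Idn_in_Hom by (simp add: D\<^sub>1_def kite_def)
  next
    case False
    then have "a = 4 \<or> a = 5 \<or> a = 6 \<or> a = 7" using that by auto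
    then show ?thesis using r s by (auto simp: D\<^sub>1_def D\<^sub>0_def kite_def)
  qed
  have Cmp: "D\<^sub>1 (b \<cdot>\<^bsub>kite\<^esub> a) = D\<^sub>1 b \<cdot> D\<^sub>1 a"
    if "a < 8" "b < 8" and eq: "Cod kite a = Dom kite b" for a b
  proof (cases "a < 4")
    case True
    then have "D\<^sub>1 b \<cdot> D\<^sub>1 a = D\<^sub>1 b"
      using Mor[OF that(2)] eq Cmp_Idn_right by (auto simp: D\<^sub>1_def kite_def)
    then show ?thesis using True by (simp add: kite_def)
  next
    \<comment> \<open>Every edge ends in a sink, so \<open>b\<close> can only be the identity
      there.\<close>
    case False
    then have "b = Cod kite a" "b < 4" using eq by (auto simp: kite_def split: if_splits)
    then have "D\<^sub>1 b \<cdot> D\<^sub>1 a = D\<^sub>1 a"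
      using Mor[OF that(1)] Cmp_Idn_left by (auto simp: D\<^sub>1_def)
    then show ?thesis using False by (simp add: kite_def)
  qed
  have "cat_functor kite C D\<^sub>0 D\<^sub>1"
    using Ob Mor Cmp by (simp add: cat_functor_def) (simp add: kite_def D\<^sub>1_def)
  then show thesis using that by (simp add: D\<^sub>1_def)
qed

end

lemma finite_kite: "finite (Ob kite)" "finite (Mor kite)"
  by (simp_all add: kite_def)

section \<open>Transfer of the Shifting Lemma\<close>

context category
begin

section \<open>Elimination rules for double pullbacks\<close>

lemma double_pullbackD:
  assumes "is_double_pullback C P p q (r\<^sub>0, r\<^sub>1) (s\<^sub>0, s\<^sub>1)"
    and "r\<^sub>0 \<in> Hom C A X" "s\<^sub>0 \<in> Hom C B X"
  shows "p \<in> Hom C P A" "q \<in> Hom C P B" "r\<^sub>0 \<cdot> p = s\<^sub>0 \<cdot> q" "r\<^sub>1 \<cdot> p = s\<^sub>1 \<cdot> q" "P \<in> Ob C"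
    "u \<in> Hom C U A \<Longrightarrow> v \<in> Hom C U B \<Longrightarrow> r\<^sub>0 \<cdot> u = s\<^sub>0 \<cdot> v \<Longrightarrow> r\<^sub>1 \<cdot> u = s\<^sub>1 \<cdot> v \<Longrightarrow>
      \<exists>!h. h \<in> Hom C U P \<and> p \<cdot> h = u \<and> q \<cdot> h = v"
proof -
  have "Dom C r\<^sub>0 = A" "Dom C s\<^sub>0 = B" using assms(2,3) by (auto simp: Hom_def)
  note pb = assms(1)[unfolded is_double_pullback_def fst_conv snd_conv this]
  show "p \<in> Hom C P A" "q \<in> Hom C P B" "r\<^sub>0 \<cdot> p = s\<^sub>0 \<cdot> q" "r\<^sub>1 \<cdot> p = s\<^sub>1 \<cdot> q" using pb by blast+
  then show "P \<in> Ob C" using Hom_Ob by blast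
  show "u \<in> Hom C U A \<Longrightarrow> v \<in> Hom C U B \<Longrightarrow> r\<^sub>0 \<cdot> u = s\<^sub>0 \<cdot> v \<Longrightarrow> r\<^sub>1 \<cdot> u = s\<^sub>1 \<cdot> v \<Longrightarrow>
      \<exists>!h. h \<in> Hom C U P \<and> p \<cdot> h = u \<and> q \<cdot> h = v"
    using pb Hom_Ob by blast
qed

lemma double_pullback_joint_mono:
  assumes pb: "is_double_pullback C P p q (r\<^sub>0, r\<^sub>1) (s\<^sub>0, s\<^sub>1)"
    and r: "r\<^sub>0 \<in> Hom C A X" "r\<^sub>1 \<in> Hom C A X" and s: "s\<^sub>0 \<in> Hom C B X" "s\<^sub>1 \<in> Hom C B X"
    and h: "h \<in> Hom C U P" and k: "k \<in> Hom C U P"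
    and "p \<cdot> h = p \<cdot> k" "q \<cdot> h = q \<cdot> k"
  shows "h = k"
proof -
  note D = double_pullbackD[OF pb r(1) s(1)]
  have "r\<^sub>0 \<cdot> (p \<cdot> h) = s\<^sub>0 \<cdot> (q \<cdot> h)" "r\<^sub>1 \<cdot> (p \<cdot> h) = s\<^sub>1 \<cdot> (q \<cdot> h)"
    using Cmp_eq_Cmp[OF D(3) h D(1) r(1) D(2) s(1)] Cmp_eq_Cmp[OF D(4) h D(1) r(2) D(2) s(2)]
    by simp_all
  then have "\<exists>!m. m \<in> Hom C U P \<and> p \<cdot> m = p \<cdot> h \<and> q \<cdot> m = q \<cdot> h"
    using D(6) Cmp_in_Hom[OF h D(1)] Cmp_in_Hom[OF h D(2)] by simp
  then show ?thesis using h k assms(8,9) by (metis (no_types, lifting))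
qed

section \<open>Relations as jointly monic pairs, tested on generalized elements\<close>

lemma relationE:
  assumes "is_relation C X (r\<^sub>0, r\<^sub>1)"
  obtains A where "r\<^sub>0 \<in> Hom C A X" "r\<^sub>1 \<in> Hom C A X"
    "\<And>U u v. u \<in> Hom C U A \<Longrightarrow> v \<in> Hom C U A \<Longrightarrow> r\<^sub>0 \<cdot> u = r\<^sub>0 \<cdot> v \<Longrightarrow> r\<^sub>1 \<cdot> u = r\<^sub>1 \<cdot> v \<Longrightarrow> u = v"
proof -
  obtain A where A: "r\<^sub>0 \<in> Hom C A X" "r\<^sub>1 \<in> Hom C A X" "\<And>U u v. U \<in> Ob C \<Longrightarrow> u \<in> Hom C U A \<Longrightarrow>
      v \<in> Hom C U A \<Longrightarrow> r\<^sub>0 \<cdot> u = r\<^sub>0 \<cdot> v \<Longrightarrow> r\<^sub>1 \<cdot> u = r\<^sub>1 \<cdot> v \<Longrightarrow> u = v"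
    using assms unfolding is_relation_def fst_conv snd_conv by blast
  show thesis by (rule that[OF A(1,2)]) (use A(3) Hom_Ob in blast)
qed

lemma relation_Hom:
  assumes "is_relation C X (r\<^sub>0, r\<^sub>1)"
  shows "\<exists>A. r\<^sub>0 \<in> Hom C A X \<and> r\<^sub>1 \<in> Hom C A X"
  by (rule relationE[OF assms]) blast

lemma relationI:
  assumes "r\<^sub>0 \<in> Hom C A X" "r\<^sub>1 \<in> Hom C A X"
    and "\<And>U u v. u \<in> Hom C U A \<Longrightarrow> v \<in> Hom C U A \<Longrightarrow> r\<^sub>0 \<cdot> u = r\<^sub>0 \<cdot> v \<Longrightarrow> r\<^sub>1 \<cdot> u = r\<^sub>1 \<cdot> v \<Longrightarrow> u = v"
  shows "is_relation C X (r\<^sub>0, r\<^sub>1)"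
  unfolding is_relation_def fst_conv snd_conv
  using assms Hom_Ob[OF assms(1)] by blast

text \<open>The definition of \<open>rel_holds\<close> leaves the domain of the witness open; the
  equation \<open>r\<^sub>0 \<cdot> h = x\<close> forces it to be that of \<open>x\<close>.\<close>

lemma rel_holds_iff:
  assumes "r\<^sub>0 \<in> Hom C A X" "x \<in> Hom C U X"
  shows "rel_holds C (r\<^sub>0, r\<^sub>1) x y \<longleftrightarrow> (\<exists>h\<in>Hom C U A. r\<^sub>0 \<cdot> h = x \<and> r\<^sub>1 \<cdot> h = y)"
proof -
  have "Dom C h = U" if "h \<in> Mor C" "Cod C h = A" "r\<^sub>0 \<cdot> h = x" for h
    using that assms Dom_Cmp[of h r\<^sub>0] by (simp add: Hom_def)
  then show ?thesis using assms unfolding rel_holds_def Hom_def fst_conv snd_conv by blast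
qed

lemma rel_le_iff:
  assumes "r\<^sub>0 \<in> Hom C A X" "s\<^sub>0 \<in> Hom C B X"
  shows "rel_le C (r\<^sub>0, r\<^sub>1) (s\<^sub>0, s\<^sub>1) \<longleftrightarrow> (\<exists>h\<in>Hom C A B. s\<^sub>0 \<cdot> h = r\<^sub>0 \<and> s\<^sub>1 \<cdot> h = r\<^sub>1)"
proof -
  have "Dom C r\<^sub>0 = A" "Dom C s\<^sub>0 = B" using assms by (simp_all add: Hom_def)
  then show ?thesis unfolding rel_le_def by simp
qed

lemma rel_le_trans:
  assumes "is_relation C X R" "is_relation C X S" "is_relation C X T"
    and "rel_le C R S" "rel_le C S T"
  shows "rel_le C R T"
proof -
  obtain r\<^sub>0 r\<^sub>1 s\<^sub>0 s\<^sub>1 t\<^sub>0 t\<^sub>1 where e: "R = (r\<^sub>0, r\<^sub>1)" "S = (s\<^sub>0, s\<^sub>1)" "T = (t\<^sub>0, t\<^sub>1)"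
    by (meson surj_pair)
  obtain A where r: "r\<^sub>0 \<in> Hom C A X" "r\<^sub>1 \<in> Hom C A X" using assms(1) e relation_Hom by blast
  obtain B where s: "s\<^sub>0 \<in> Hom C B X" "s\<^sub>1 \<in> Hom C B X" using assms(2) e relation_Hom by blast
  obtain D where t: "t\<^sub>0 \<in> Hom C D X" "t\<^sub>1 \<in> Hom C D X" using assms(3) e relation_Hom by blast
  obtain h where h: "h \<in> Hom C A B" "s\<^sub>0 \<cdot> h = r\<^sub>0" "s\<^sub>1 \<cdot> h = r\<^sub>1"
    using assms(4) rel_le_iff[OF r(1) s(1)] e by blast
  obtain k where k: "k \<in> Hom C B D" "t\<^sub>0 \<cdot> k = s\<^sub>0" "t\<^sub>1 \<cdot> k = s\<^sub>1"
    using assms(5) rel_le_iff[OF s(1) t(1)] e by blast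
  have "t\<^sub>0 \<cdot> (k \<cdot> h) = r\<^sub>0" "t\<^sub>1 \<cdot> (k \<cdot> h) = r\<^sub>1"
    using Cmp_eq_single[OF k(2) h(1) k(1) t(1)] Cmp_eq_single[OF k(3) h(1) k(1) t(2)] h by simp_all
  then show ?thesis using rel_le_iff[OF r(1) t(1)] Cmp_in_Hom[OF h(1) k(1)] e by blast
qed

text \<open>A relation below both \<open>R\<close> and \<open>S\<close> comes with factorizations
  through each of them, and such a pair is exactly a cone over the kite. This exhibits the
  order-theoretic infimum as a finite limit, which is what functors can be expected to
  preserve.\<close>

lemma double_pullback_intersection:
  assumes R: "is_relation C X (r\<^sub>0, r\<^sub>1)" and S: "is_relation C X (s\<^sub>0, s\<^sub>1)"
    and pb: "is_double_pullback C P p q (r\<^sub>0, r\<^sub>1) (s\<^sub>0, s\<^sub>1)"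
  shows "is_intersection C X (r\<^sub>0 \<cdot> p, r\<^sub>1 \<cdot> p) (r\<^sub>0, r\<^sub>1) (s\<^sub>0, s\<^sub>1)"
proof -
  obtain A where r: "r\<^sub>0 \<in> Hom C A X" "r\<^sub>1 \<in> Hom C A X" and r_mono:
      "\<And>U u v. u \<in> Hom C U A \<Longrightarrow> v \<in> Hom C U A \<Longrightarrow> r\<^sub>0 \<cdot> u = r\<^sub>0 \<cdot> v \<Longrightarrow> r\<^sub>1 \<cdot> u = r\<^sub>1 \<cdot> v \<Longrightarrow> u = v"
    using relationE[OF R] by blast
  obtain B where s: "s\<^sub>0 \<in> Hom C B X" "s\<^sub>1 \<in> Hom C B X" and s_mono:
      "\<And>U u v. u \<in> Hom C U B \<Longrightarrow> v \<in> Hom C U B \<Longrightarrow> s\<^sub>0 \<cdot> u = s\<^sub>0 \<cdot> v \<Longrightarrow> s\<^sub>1 \<cdot> u = s\<^sub>1 \<cdot> v \<Longrightarrow> u = v"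
    using relationE[OF S] by blast
  note D = double_pullbackD[OF pb r(1) s(1)]
  have rp: "r\<^sub>0 \<cdot> p \<in> Hom C P X" "r\<^sub>1 \<cdot> p \<in> Hom C P X" using D(1) r Cmp_in_Hom by auto
  have "is_relation C X (r\<^sub>0 \<cdot> p, r\<^sub>1 \<cdot> p)"
  proof (rule relationI[OF rp])
    fix U u v assume u: "u \<in> Hom C U P" and v: "v \<in> Hom C U P"
      and eq: "(r\<^sub>0 \<cdot> p) \<cdot> u = (r\<^sub>0 \<cdot> p) \<cdot> v" "(r\<^sub>1 \<cdot> p) \<cdot> u = (r\<^sub>1 \<cdot> p) \<cdot> v"
    have "p \<cdot> u = p \<cdot> v"
      using eq Cmp_assoc[OF u D(1) r(1)] Cmp_assoc[OF v D(1) r(1)]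
        Cmp_assoc[OF u D(1) r(2)] Cmp_assoc[OF v D(1) r(2)]
        r_mono[OF Cmp_in_Hom[OF u D(1)] Cmp_in_Hom[OF v D(1)]] by simp
    \<comment> \<open>The assumed equations speak of \<open>r\<^sub>0 \<cdot> p\<close> and
      \<open>r\<^sub>1 \<cdot> p\<close>, which are also \<open>s\<^sub>0 \<cdot> q\<close> and
      \<open>s\<^sub>1 \<cdot> q\<close>.\<close>
    moreover have "q \<cdot> u = q \<cdot> v"
    proof (rule s_mono[OF Cmp_in_Hom[OF u D(2)] Cmp_in_Hom[OF v D(2)]])
      show "s\<^sub>0 \<cdot> (q \<cdot> u) = s\<^sub>0 \<cdot> (q \<cdot> v)"
        using eq(1) Cmp_assoc[OF u D(2) s(1)] Cmp_assoc[OF v D(2) s(1)] D(3) by simp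
      show "s\<^sub>1 \<cdot> (q \<cdot> u) = s\<^sub>1 \<cdot> (q \<cdot> v)"
        using eq(2) Cmp_assoc[OF u D(2) s(2)] Cmp_assoc[OF v D(2) s(2)] D(4) by simp
    qed
    ultimately show "u = v" using double_pullback_joint_mono[OF pb r s u v] by blast
  qed
  moreover have "rel_le C (r\<^sub>0 \<cdot> p, r\<^sub>1 \<cdot> p) (r\<^sub>0, r\<^sub>1)" "rel_le C (r\<^sub>0 \<cdot> p, r\<^sub>1 \<cdot> p) (s\<^sub>0, s\<^sub>1)"
    using rel_le_iff[OF rp(1) r(1)] rel_le_iff[OF rp(1) s(1)] D by auto
  moreover have "rel_le C V (r\<^sub>0 \<cdot> p, r\<^sub>1 \<cdot> p)"
    if V: "is_relation C X V" "rel_le C V (r\<^sub>0, r\<^sub>1)" "rel_le C V (s\<^sub>0, s\<^sub>1)" for V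
  proof -
    obtain v\<^sub>0 v\<^sub>1 where e: "V = (v\<^sub>0, v\<^sub>1)" by (meson surj_pair)
    obtain K where v: "v\<^sub>0 \<in> Hom C K X" "v\<^sub>1 \<in> Hom C K X" using V(1) e relation_Hom by blast
    obtain a where a: "a \<in> Hom C K A" "r\<^sub>0 \<cdot> a = v\<^sub>0" "r\<^sub>1 \<cdot> a = v\<^sub>1"
      using V(2) rel_le_iff[OF v(1) r(1)] e by blast
    obtain b where b: "b \<in> Hom C K B" "s\<^sub>0 \<cdot> b = v\<^sub>0" "s\<^sub>1 \<cdot> b = v\<^sub>1"
      using V(3) rel_le_iff[OF v(1) s(1)] e by blast
    obtain h where h: "h \<in> Hom C K P" "p \<cdot> h = a"
      using D(6)[OF a(1) b(1)] a b by auto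
    have "(r\<^sub>0 \<cdot> p) \<cdot> h = v\<^sub>0" "(r\<^sub>1 \<cdot> p) \<cdot> h = v\<^sub>1"
      using Cmp_assoc[OF h(1) D(1) r(1)] Cmp_assoc[OF h(1) D(1) r(2)] h(2) a by simp_all
    then show ?thesis using h(1) rel_le_iff[OF v(1) rp(1)] e by blast
  qed
  ultimately show ?thesis unfolding is_intersection_def by blast
qed

text \<open>Here \<open>d\<close>, \<open>t\<close> and \<open>m\<close> are the diagonal, the swap
  and the transitivity map, the latter defined on the object \<open>P\<close> of pairs with
  \<open>r\<^sub>1 \<cdot> p = r\<^sub>0 \<cdot> q\<close>. Composing a generalized element with
  them gives the three properties over every object at once. Being equations over a limit, these
  data pass through functors, unlike the quantification over all objects.\<close>

lemma equivalence_relationI: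
  assumes R: "is_relation C X (r\<^sub>0, r\<^sub>1)" and r\<^sub>0: "r\<^sub>0 \<in> Hom C A X" and r\<^sub>1: "r\<^sub>1 \<in> Hom C A X"
    and d: "d \<in> Hom C X A" "r\<^sub>0 \<cdot> d = Idn C X" "r\<^sub>1 \<cdot> d = Idn C X"
    and t: "t \<in> Hom C A A" "r\<^sub>0 \<cdot> t = r\<^sub>1" "r\<^sub>1 \<cdot> t = r\<^sub>0"
    and pb: "is_double_pullback C P p q (r\<^sub>1, r\<^sub>1) (r\<^sub>0, r\<^sub>0)"
    and m: "m \<in> Hom C P A" "r\<^sub>0 \<cdot> m = r\<^sub>0 \<cdot> p" "r\<^sub>1 \<cdot> m = r\<^sub>1 \<cdot> q"
  shows "is_equivalence_relation C X (r\<^sub>0, r\<^sub>1)"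
  unfolding is_equivalence_relation_def
proof (intro conjI ballI R)
  fix U
  let ?R = "{(x, y) \<in> Hom C U X \<times> Hom C U X. rel_holds C (r\<^sub>0, r\<^sub>1) x y}"
  have iff: "(x, y) \<in> ?R \<longleftrightarrow> x \<in> Hom C U X \<and> y \<in> Hom C U X \<and>
      (\<exists>h\<in>Hom C U A. r\<^sub>0 \<cdot> h = x \<and> r\<^sub>1 \<cdot> h = y)" for x y
    using rel_holds_iff[OF r\<^sub>0, of x U] by auto
  have "(x, x) \<in> ?R" if x: "x \<in> Hom C U X" for x
  proof -
    have "r\<^sub>0 \<cdot> (d \<cdot> x) = x" "r\<^sub>1 \<cdot> (d \<cdot> x) = x"
      using Cmp_eq_single[OF d(2) x d(1) r\<^sub>0] Cmp_eq_single[OF d(3) x d(1) r\<^sub>1] Cmp_Idn_left[OF x]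
      by simp_all
    then show ?thesis unfolding iff using x Cmp_in_Hom[OF x d(1)] by blast
  qed
  then have "refl_on (Hom C U X) ?R" by (rule refl_onI)
  moreover have "(y, x) \<in> ?R" if R: "(x, y) \<in> ?R" for x y
  proof -
    obtain h where xy: "x \<in> Hom C U X" "y \<in> Hom C U X"
      and h: "h \<in> Hom C U A" "r\<^sub>0 \<cdot> h = x" "r\<^sub>1 \<cdot> h = y" using R unfolding iff by blast
    have "r\<^sub>0 \<cdot> (t \<cdot> h) = y" "r\<^sub>1 \<cdot> (t \<cdot> h) = x"
      using Cmp_eq_single[OF t(2) h(1) t(1) r\<^sub>0] Cmp_eq_single[OF t(3) h(1) t(1) r\<^sub>1] h by simp_all
    then show ?thesis unfolding iff using xy Cmp_in_Hom[OF h(1) t(1)] by blast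
  qed
  then have "sym ?R" by (rule symI)
  moreover have "(x, z) \<in> ?R" if R: "(x, y) \<in> ?R" "(y, z) \<in> ?R" for x y z
  proof -
    obtain h k where xz: "x \<in> Hom C U X" "z \<in> Hom C U X"
      and h: "h \<in> Hom C U A" "r\<^sub>0 \<cdot> h = x" "r\<^sub>1 \<cdot> h = y"
      and k: "k \<in> Hom C U A" "r\<^sub>0 \<cdot> k = y" "r\<^sub>1 \<cdot> k = z" using R unfolding iff by blast
    note D = double_pullbackD[OF pb r\<^sub>1 r\<^sub>0]
    obtain w where w: "w \<in> Hom C U P" "p \<cdot> w = h" "q \<cdot> w = k"
      using D(6)[OF h(1) k(1)] h k by auto
    have "r\<^sub>0 \<cdot> (m \<cdot> w) = x" "r\<^sub>1 \<cdot> (m \<cdot> w) = z"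
      using Cmp_eq_Cmp[OF m(2) w(1) m(1) r\<^sub>0 D(1) r\<^sub>0] Cmp_eq_Cmp[OF m(3) w(1) m(1) r\<^sub>1 D(2) r\<^sub>1]
        w h k by simp_all
    then show ?thesis unfolding iff using xz Cmp_in_Hom[OF w(1) m(1)] by blast
  qed
  then have "trans ?R" by (rule transI)
  moreover have "?R \<subseteq> Hom C U X \<times> Hom C U X" by blast
  ultimately show "equiv (Hom C U X) ?R" by (intro equivI)
qed

text \<open>A Yoneda argument: the properties are evaluated at generic elements. Reflexivity at the
  identity of \<open>X\<close> gives \<open>d\<close>, symmetry at the pair
  \<open>(r\<^sub>0, r\<^sub>1)\<close> over \<open>A\<close> gives \<open>t\<close>, and
  transitivity at a matching pair \<open>p\<close>, \<open>q\<close> gives \<open>m\<close>.\<close>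

lemma equivalence_relationE:
  assumes R: "is_equivalence_relation C X (r\<^sub>0, r\<^sub>1)"
    and r\<^sub>0: "r\<^sub>0 \<in> Hom C A X" and r\<^sub>1: "r\<^sub>1 \<in> Hom C A X"
  shows "\<exists>d\<in>Hom C X A. r\<^sub>0 \<cdot> d = Idn C X \<and> r\<^sub>1 \<cdot> d = Idn C X"
    and "\<exists>t\<in>Hom C A A. r\<^sub>0 \<cdot> t = r\<^sub>1 \<and> r\<^sub>1 \<cdot> t = r\<^sub>0"
    and "p \<in> Hom C P A \<Longrightarrow> q \<in> Hom C P A \<Longrightarrow> r\<^sub>1 \<cdot> p = r\<^sub>0 \<cdot> q \<Longrightarrow>
      \<exists>m\<in>Hom C P A. r\<^sub>0 \<cdot> m = r\<^sub>0 \<cdot> p \<and> r\<^sub>1 \<cdot> m = r\<^sub>1 \<cdot> q"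
proof -
  let ?R = "\<lambda>U. {(x, y) \<in> Hom C U X \<times> Hom C U X. rel_holds C (r\<^sub>0, r\<^sub>1) x y}"
  have equiv: "equiv (Hom C U X) (?R U)" if "U \<in> Ob C" for U
    using R that unfolding is_equivalence_relation_def by blast
  have iff: "(x, y) \<in> ?R U \<longleftrightarrow> x \<in> Hom C U X \<and> y \<in> Hom C U X \<and>
      (\<exists>h\<in>Hom C U A. r\<^sub>0 \<cdot> h = x \<and> r\<^sub>1 \<cdot> h = y)" for U x y
    using rel_holds_iff[OF r\<^sub>0, of x U] by auto
  have X: "X \<in> Ob C" and A: "A \<in> Ob C" using Hom_Ob[OF r\<^sub>0] by auto
  have "(Idn C X, Idn C X) \<in> ?R X"
    using equiv[OF X] Idn_in_Hom[OF X] by (meson equivE refl_onD)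
  then show "\<exists>d\<in>Hom C X A. r\<^sub>0 \<cdot> d = Idn C X \<and> r\<^sub>1 \<cdot> d = Idn C X" unfolding iff by blast
  have "(r\<^sub>0, r\<^sub>1) \<in> ?R A" unfolding iff
    using r\<^sub>0 r\<^sub>1 Cmp_Idn_right[OF r\<^sub>0] Cmp_Idn_right[OF r\<^sub>1] Idn_in_Hom[OF A] by blast
  then have "(r\<^sub>1, r\<^sub>0) \<in> ?R A" using equiv[OF A] by (meson equivE symD)
  then show "\<exists>t\<in>Hom C A A. r\<^sub>0 \<cdot> t = r\<^sub>1 \<and> r\<^sub>1 \<cdot> t = r\<^sub>0" unfolding iff by blast
  assume p: "p \<in> Hom C P A" and q: "q \<in> Hom C P A" and eq: "r\<^sub>1 \<cdot> p = r\<^sub>0 \<cdot> q"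
  have "(r\<^sub>0 \<cdot> p, r\<^sub>1 \<cdot> p) \<in> ?R P" "(r\<^sub>1 \<cdot> p, r\<^sub>1 \<cdot> q) \<in> ?R P"
    unfolding iff using p q eq Cmp_in_Hom[OF p r\<^sub>0] Cmp_in_Hom[OF p r\<^sub>1] Cmp_in_Hom[OF q r\<^sub>1]
    by auto
  then have "(r\<^sub>0 \<cdot> p, r\<^sub>1 \<cdot> q) \<in> ?R P"
    using equiv[of P] Hom_Ob[OF p] by (meson equivE transD)
  then show "\<exists>m\<in>Hom C P A. r\<^sub>0 \<cdot> m = r\<^sub>0 \<cdot> p \<and> r\<^sub>1 \<cdot> m = r\<^sub>1 \<cdot> q" unfolding iff by blast
qed

end

text \<open>This isolates what the transfer requires of the level functors. The assumption
  \<open>kite_limit\<close> asks for one limit in \<open>C\<close> that all functors preserve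
  simultaneously. The assumption \<open>reflect\<close> is the only passage from \<open>E\<close>
  back to \<open>C\<close>, and it may use that the images of the pair are jointly monic.\<close>

locale relation_reflecting_family =
  C: category C + E: category E
  for C :: "('a, 'b) cat" and E :: "('o, 'm) cat" +
  fixes \<Phi>\<^sub>0 :: "'i \<Rightarrow> 'a \<Rightarrow> 'o" and \<Phi>\<^sub>1 :: "'i \<Rightarrow> 'b \<Rightarrow> 'm"
  assumes \<Phi>_functor: "cat_functor C E (\<Phi>\<^sub>0 n) (\<Phi>\<^sub>1 n)"
    and kite_limit: "cat_functor kite C D\<^sub>0 D\<^sub>1 \<Longrightarrow> \<exists>L l. is_limit kite C D\<^sub>0 D\<^sub>1 L l \<and>
      (\<forall>n. is_limit kite E (\<lambda>i. \<Phi>\<^sub>0 n (D\<^sub>0 i)) (\<lambda>a. \<Phi>\<^sub>1 n (D\<^sub>1 a)) (\<Phi>\<^sub>0 n L) (\<lambda>i. \<Phi>\<^sub>1 n (l i)))"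
    and reflect: "t\<^sub>0 \<in> Hom C A X \<Longrightarrow> t\<^sub>1 \<in> Hom C A X \<Longrightarrow> x \<in> Hom C U X \<Longrightarrow> y \<in> Hom C U X \<Longrightarrow>
      (\<And>n. is_relation E (\<Phi>\<^sub>0 n X) (\<Phi>\<^sub>1 n t\<^sub>0, \<Phi>\<^sub>1 n t\<^sub>1)) \<Longrightarrow>
      (\<And>n. rel_holds E (\<Phi>\<^sub>1 n t\<^sub>0, \<Phi>\<^sub>1 n t\<^sub>1) (\<Phi>\<^sub>1 n x) (\<Phi>\<^sub>1 n y)) \<Longrightarrow> rel_holds C (t\<^sub>0, t\<^sub>1) x y"
begin

lemma \<Phi>_Hom: "f \<in> Hom C A B \<Longrightarrow> \<Phi>\<^sub>1 n f \<in> Hom E (\<Phi>\<^sub>0 n A) (\<Phi>\<^sub>0 n B)"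
  using \<Phi>_functor[of n] by (auto simp: cat_functor_def Hom_def)

lemma \<Phi>_Idn: "A \<in> Ob C \<Longrightarrow> \<Phi>\<^sub>1 n (Idn C A) = Idn E (\<Phi>\<^sub>0 n A)"
  using \<Phi>_functor[of n] by (auto simp: cat_functor_def)

lemma \<Phi>_Cmp: "f \<in> Hom C A B \<Longrightarrow> g \<in> Hom C B D \<Longrightarrow> \<Phi>\<^sub>1 n (g \<cdot>\<^bsub>C\<^esub> f) = \<Phi>\<^sub>1 n g \<cdot>\<^bsub>E\<^esub> \<Phi>\<^sub>1 n f"
  using \<Phi>_functor[of n] by (auto simp: cat_functor_def Hom_def)

section \<open>Images of relations under the functors of the family\<close>

lemma double_pullback:
  assumes "r\<^sub>0 \<in> Hom C A X" "r\<^sub>1 \<in> Hom C A X" "s\<^sub>0 \<in> Hom C B X" "s\<^sub>1 \<in> Hom C B X"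
  shows "\<exists>P p q. is_double_pullback C P p q (r\<^sub>0, r\<^sub>1) (s\<^sub>0, s\<^sub>1) \<and>
    (\<forall>n. is_double_pullback E (\<Phi>\<^sub>0 n P) (\<Phi>\<^sub>1 n p) (\<Phi>\<^sub>1 n q)
      (\<Phi>\<^sub>1 n r\<^sub>0, \<Phi>\<^sub>1 n r\<^sub>1) (\<Phi>\<^sub>1 n s\<^sub>0, \<Phi>\<^sub>1 n s\<^sub>1))"
proof -
  obtain D\<^sub>0 D\<^sub>1 where D: "cat_functor kite C D\<^sub>0 D\<^sub>1"
    and [simp]: "D\<^sub>1 4 = r\<^sub>0" "D\<^sub>1 5 = r\<^sub>1" "D\<^sub>1 6 = s\<^sub>0" "D\<^sub>1 7 = s\<^sub>1"
    using C.cat_functor_kite[OF assms] by metis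
  obtain L l where L: "is_limit kite C D\<^sub>0 D\<^sub>1 L l" and
    L_n: "\<And>n. is_limit kite E (\<lambda>i. \<Phi>\<^sub>0 n (D\<^sub>0 i)) (\<lambda>a. \<Phi>\<^sub>1 n (D\<^sub>1 a)) (\<Phi>\<^sub>0 n L) (\<lambda>i. \<Phi>\<^sub>1 n (l i))"
    using kite_limit[OF D] by blast
  have "cat_functor kite E (\<lambda>i. \<Phi>\<^sub>0 n (D\<^sub>0 i)) (\<lambda>a. \<Phi>\<^sub>1 n (D\<^sub>1 a))" for n
    using D \<Phi>_functor[of n] by (auto simp: cat_functor_def Hom_def)
  note E.limit_kite[OF L_n this]
  then show ?thesis using C.limit_kite[OF L D] by (intro exI[of _ L] exI[of _ "l 0"] exI[of _ "l 1"]) simp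
qed

text \<open>A pair is jointly monic exactly when the two legs of its joint kernel pair agree, and
  this equality is preserved once the kernel pair is.\<close>

lemma relation_image:
  assumes "is_relation C X (r\<^sub>0, r\<^sub>1)"
  shows "is_relation E (\<Phi>\<^sub>0 n X) (\<Phi>\<^sub>1 n r\<^sub>0, \<Phi>\<^sub>1 n r\<^sub>1)"
proof -
  obtain A where r: "r\<^sub>0 \<in> Hom C A X" "r\<^sub>1 \<in> Hom C A X" and mono: "\<And>U u v. u \<in> Hom C U A \<Longrightarrow>
      v \<in> Hom C U A \<Longrightarrow> r\<^sub>0 \<cdot>\<^bsub>C\<^esub> u = r\<^sub>0 \<cdot>\<^bsub>C\<^esub> v \<Longrightarrow> r\<^sub>1 \<cdot>\<^bsub>C\<^esub> u = r\<^sub>1 \<cdot>\<^bsub>C\<^esub> v \<Longrightarrow> u = v"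
    using C.relationE[OF assms] by blast
  obtain P p q where P: "is_double_pullback C P p q (r\<^sub>0, r\<^sub>1) (r\<^sub>0, r\<^sub>1)"
    and P_n: "is_double_pullback E (\<Phi>\<^sub>0 n P) (\<Phi>\<^sub>1 n p) (\<Phi>\<^sub>1 n q)
      (\<Phi>\<^sub>1 n r\<^sub>0, \<Phi>\<^sub>1 n r\<^sub>1) (\<Phi>\<^sub>1 n r\<^sub>0, \<Phi>\<^sub>1 n r\<^sub>1)"
    using double_pullback[OF r r] by blast
  \<comment> \<open>In \<open>E\<close>, morphisms identified by the image pair factor through the
    images of \<open>p\<close> and \<open>q\<close> by a common morphism, so this equality makes
    them equal.\<close>
  have "p = q"
    using mono[of p P q] C.double_pullbackD(1-4)[OF P r(1) r(1)] by simp
  note r_n = \<Phi>_Hom[OF r(1), of n] \<Phi>_Hom[OF r(2), of n]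
  show ?thesis
  proof (rule E.relationI[OF r_n])
    fix U u v assume "u \<in> Hom E U (\<Phi>\<^sub>0 n A)" "v \<in> Hom E U (\<Phi>\<^sub>0 n A)"
      "\<Phi>\<^sub>1 n r\<^sub>0 \<cdot>\<^bsub>E\<^esub> u = \<Phi>\<^sub>1 n r\<^sub>0 \<cdot>\<^bsub>E\<^esub> v" "\<Phi>\<^sub>1 n r\<^sub>1 \<cdot>\<^bsub>E\<^esub> u = \<Phi>\<^sub>1 n r\<^sub>1 \<cdot>\<^bsub>E\<^esub> v"
    from E.double_pullbackD(6)[OF P_n r_n(1) r_n(1) this]
    show "u = v" using \<open>p = q\<close> by auto
  qed
qed

text \<open>The maps \<open>d\<close>, \<open>t\<close> and \<open>m\<close> are extracted in
  \<open>C\<close>, sent to \<open>E\<close> with their equations, and there yield the elementwise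
  properties over arbitrary objects, including those outside the image of the functor.\<close>

lemma equivalence_relation_image:
  assumes R: "is_equivalence_relation C X (r\<^sub>0, r\<^sub>1)"
  shows "is_equivalence_relation E (\<Phi>\<^sub>0 n X) (\<Phi>\<^sub>1 n r\<^sub>0, \<Phi>\<^sub>1 n r\<^sub>1)"
proof -
  have rel: "is_relation C X (r\<^sub>0, r\<^sub>1)" using R by (simp add: is_equivalence_relation_def)
  obtain A where r: "r\<^sub>0 \<in> Hom C A X" "r\<^sub>1 \<in> Hom C A X" using C.relation_Hom[OF rel] by blast
  have X: "X \<in> Ob C" using C.Hom_Ob[OF r(1)] by blast
  obtain d where d: "d \<in> Hom C X A" "r\<^sub>0 \<cdot>\<^bsub>C\<^esub> d = Idn C X" "r\<^sub>1 \<cdot>\<^bsub>C\<^esub> d = Idn C X"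
    using C.equivalence_relationE(1)[OF R r] by blast
  obtain t where t: "t \<in> Hom C A A" "r\<^sub>0 \<cdot>\<^bsub>C\<^esub> t = r\<^sub>1" "r\<^sub>1 \<cdot>\<^bsub>C\<^esub> t = r\<^sub>0"
    using C.equivalence_relationE(2)[OF R r] by blast
  obtain P p q where P: "is_double_pullback C P p q (r\<^sub>1, r\<^sub>1) (r\<^sub>0, r\<^sub>0)"
    and P_n: "is_double_pullback E (\<Phi>\<^sub>0 n P) (\<Phi>\<^sub>1 n p) (\<Phi>\<^sub>1 n q)
      (\<Phi>\<^sub>1 n r\<^sub>1, \<Phi>\<^sub>1 n r\<^sub>1) (\<Phi>\<^sub>1 n r\<^sub>0, \<Phi>\<^sub>1 n r\<^sub>0)"
    using double_pullback[OF r(2) r(2) r(1) r(1)] by blast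
  note D = C.double_pullbackD[OF P r(2) r(1)]
  obtain m where m: "m \<in> Hom C P A" "r\<^sub>0 \<cdot>\<^bsub>C\<^esub> m = r\<^sub>0 \<cdot>\<^bsub>C\<^esub> p" "r\<^sub>1 \<cdot>\<^bsub>C\<^esub> m = r\<^sub>1 \<cdot>\<^bsub>C\<^esub> q"
    using C.equivalence_relationE(3)[OF R r D(1,2,3)] by blast
  show ?thesis
  proof (rule E.equivalence_relationI[OF relation_image[OF rel] \<Phi>_Hom[OF r(1)] \<Phi>_Hom[OF r(2)]
        \<Phi>_Hom[OF d(1)] _ _ \<Phi>_Hom[OF t(1)] _ _ P_n \<Phi>_Hom[OF m(1)]])
    show "\<Phi>\<^sub>1 n r\<^sub>0 \<cdot>\<^bsub>E\<^esub> \<Phi>\<^sub>1 n d = Idn E (\<Phi>\<^sub>0 n X)" "\<Phi>\<^sub>1 n r\<^sub>1 \<cdot>\<^bsub>E\<^esub> \<Phi>\<^sub>1 n d = Idn E (\<Phi>\<^sub>0 n X)"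
      using \<Phi>_Cmp[OF d(1) r(1), of n] \<Phi>_Cmp[OF d(1) r(2), of n] d \<Phi>_Idn[OF X] by simp_all
    show "\<Phi>\<^sub>1 n r\<^sub>0 \<cdot>\<^bsub>E\<^esub> \<Phi>\<^sub>1 n t = \<Phi>\<^sub>1 n r\<^sub>1" "\<Phi>\<^sub>1 n r\<^sub>1 \<cdot>\<^bsub>E\<^esub> \<Phi>\<^sub>1 n t = \<Phi>\<^sub>1 n r\<^sub>0"
      using \<Phi>_Cmp[OF t(1) r(1), of n] \<Phi>_Cmp[OF t(1) r(2), of n] t by simp_all
    show "\<Phi>\<^sub>1 n r\<^sub>0 \<cdot>\<^bsub>E\<^esub> \<Phi>\<^sub>1 n m = \<Phi>\<^sub>1 n r\<^sub>0 \<cdot>\<^bsub>E\<^esub> \<Phi>\<^sub>1 n p"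
      using \<Phi>_Cmp[OF m(1) r(1), of n] \<Phi>_Cmp[OF D(1) r(1), of n] m by simp
    show "\<Phi>\<^sub>1 n r\<^sub>1 \<cdot>\<^bsub>E\<^esub> \<Phi>\<^sub>1 n m = \<Phi>\<^sub>1 n r\<^sub>1 \<cdot>\<^bsub>E\<^esub> \<Phi>\<^sub>1 n q"
      using \<Phi>_Cmp[OF m(1) r(2), of n] \<Phi>_Cmp[OF D(2) r(2), of n] m by simp
  qed
qed

lemma rel_le_image:
  assumes "is_relation C X (r\<^sub>0, r\<^sub>1)" "is_relation C X (s\<^sub>0, s\<^sub>1)" "rel_le C (r\<^sub>0, r\<^sub>1) (s\<^sub>0, s\<^sub>1)"
  shows "rel_le E (\<Phi>\<^sub>1 n r\<^sub>0, \<Phi>\<^sub>1 n r\<^sub>1) (\<Phi>\<^sub>1 n s\<^sub>0, \<Phi>\<^sub>1 n s\<^sub>1)"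
proof -
  obtain A where r: "r\<^sub>0 \<in> Hom C A X" using C.relation_Hom[OF assms(1)] by blast
  obtain B where s: "s\<^sub>0 \<in> Hom C B X" "s\<^sub>1 \<in> Hom C B X" using C.relation_Hom[OF assms(2)] by blast
  obtain h where h: "h \<in> Hom C A B" "s\<^sub>0 \<cdot>\<^bsub>C\<^esub> h = r\<^sub>0" "s\<^sub>1 \<cdot>\<^bsub>C\<^esub> h = r\<^sub>1"
    using assms(3) C.rel_le_iff[OF r s(1)] by blast
  then show ?thesis
    using E.rel_le_iff[OF \<Phi>_Hom[OF r, of n] \<Phi>_Hom[OF s(1), of n]] \<Phi>_Hom[OF h(1), of n]
      \<Phi>_Cmp[OF h(1) s(1), of n] \<Phi>_Cmp[OF h(1) s(2), of n] by auto
qed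

lemma rel_holds_image:
  assumes "is_relation C X (r\<^sub>0, r\<^sub>1)" "x \<in> Hom C U X" "rel_holds C (r\<^sub>0, r\<^sub>1) x y"
  shows "rel_holds E (\<Phi>\<^sub>1 n r\<^sub>0, \<Phi>\<^sub>1 n r\<^sub>1) (\<Phi>\<^sub>1 n x) (\<Phi>\<^sub>1 n y)"
proof -
  obtain A where r: "r\<^sub>0 \<in> Hom C A X" "r\<^sub>1 \<in> Hom C A X" using C.relation_Hom[OF assms(1)] by blast
  obtain h where h: "h \<in> Hom C U A" "r\<^sub>0 \<cdot>\<^bsub>C\<^esub> h = x" "r\<^sub>1 \<cdot>\<^bsub>C\<^esub> h = y"
    using assms(3) C.rel_holds_iff[OF r(1) assms(2)] by blast
  then show ?thesis
    using E.rel_holds_iff[OF \<Phi>_Hom[OF r(1), of n] \<Phi>_Hom[OF assms(2), of n]] \<Phi>_Hom[OF h(1), of n]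
      \<Phi>_Cmp[OF h(1) r(1), of n] \<Phi>_Cmp[OF h(1) r(2), of n] by auto
qed

lemma shifting_lemma_transfer:
  assumes E: "shifting_lemma E"
  shows "shifting_lemma C"
  unfolding shifting_lemma_def
proof (intro allI impI ballI, elim conjE)
  fix X R S T W U x y x' y'
  assume RST: "is_equivalence_relation C X R" "is_equivalence_relation C X S"
      "is_equivalence_relation C X T"
    and W: "is_intersection C X W R S" "rel_le C W T"
    and xy: "x \<in> Hom C U X" "y \<in> Hom C U X" "x' \<in> Hom C U X" "y' \<in> Hom C U X"
    and hyps: "rel_holds C S x y" "rel_holds C S x' y'" "rel_holds C R x x'"
      "rel_holds C R y y'" "rel_holds C T x x'"
  obtain r\<^sub>0 r\<^sub>1 s\<^sub>0 s\<^sub>1 t\<^sub>0 t\<^sub>1 where e: "R = (r\<^sub>0, r\<^sub>1)" "S = (s\<^sub>0, s\<^sub>1)" "T = (t\<^sub>0, t\<^sub>1)"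
    by (meson surj_pair)
  have rel: "is_relation C X (r\<^sub>0, r\<^sub>1)" "is_relation C X (s\<^sub>0, s\<^sub>1)" "is_relation C X (t\<^sub>0, t\<^sub>1)"
    using RST e by (auto simp: is_equivalence_relation_def)
  obtain A where r: "r\<^sub>0 \<in> Hom C A X" "r\<^sub>1 \<in> Hom C A X" using C.relation_Hom[OF rel(1)] by blast
  obtain B where s: "s\<^sub>0 \<in> Hom C B X" "s\<^sub>1 \<in> Hom C B X" using C.relation_Hom[OF rel(2)] by blast
  obtain D where t: "t\<^sub>0 \<in> Hom C D X" "t\<^sub>1 \<in> Hom C D X" using C.relation_Hom[OF rel(3)] by blast
  obtain P p q where P: "is_double_pullback C P p q (r\<^sub>0, r\<^sub>1) (s\<^sub>0, s\<^sub>1)"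
    and P_n: "\<And>n. is_double_pullback E (\<Phi>\<^sub>0 n P) (\<Phi>\<^sub>1 n p) (\<Phi>\<^sub>1 n q)
      (\<Phi>\<^sub>1 n r\<^sub>0, \<Phi>\<^sub>1 n r\<^sub>1) (\<Phi>\<^sub>1 n s\<^sub>0, \<Phi>\<^sub>1 n s\<^sub>1)"
    using double_pullback[OF r s] by blast
  have p: "p \<in> Hom C P A" using C.double_pullbackD(1)[OF P r(1) s(1)] .
  \<comment> \<open>The given \<open>W\<close> is only an abstract infimum. It is exchanged for this
    limit model, whose images are again limits and hence intersections in \<open>E\<close>.\<close>
  let ?V = "(r\<^sub>0 \<cdot>\<^bsub>C\<^esub> p, r\<^sub>1 \<cdot>\<^bsub>C\<^esub> p)"
  have V: "is_relation C X ?V" "rel_le C ?V R" "rel_le C ?V S"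
    using C.double_pullback_intersection[OF rel(1,2) P] e unfolding is_intersection_def by blast+
  \<comment> \<open>As a lower bound of \<open>R\<close> and \<open>S\<close>, the relation
    \<open>?V\<close> lies below \<open>W\<close>, and \<open>W\<close> lies below
    \<open>T\<close>.\<close>
  have "rel_le C ?V T"
    by (rule C.rel_le_trans[of X _ W]) (use V W rel e in \<open>auto simp: is_intersection_def\<close>)
  show "rel_holds C T y y'"
    unfolding e
  proof (rule reflect[OF t xy(2,4)])
    show "is_relation E (\<Phi>\<^sub>0 n X) (\<Phi>\<^sub>1 n t\<^sub>0, \<Phi>\<^sub>1 n t\<^sub>1)" for n using relation_image[OF rel(3)] .
    fix n
    have "is_intersection E (\<Phi>\<^sub>0 n X) (\<Phi>\<^sub>1 n (r\<^sub>0 \<cdot>\<^bsub>C\<^esub> p), \<Phi>\<^sub>1 n (r\<^sub>1 \<cdot>\<^bsub>C\<^esub> p))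
        (\<Phi>\<^sub>1 n r\<^sub>0, \<Phi>\<^sub>1 n r\<^sub>1) (\<Phi>\<^sub>1 n s\<^sub>0, \<Phi>\<^sub>1 n s\<^sub>1)"
      using E.double_pullback_intersection[OF relation_image[OF rel(1)] relation_image[OF rel(2)] P_n]
      unfolding \<Phi>_Cmp[OF p r(1)] \<Phi>_Cmp[OF p r(2)] .
    moreover have "rel_le E (\<Phi>\<^sub>1 n (r\<^sub>0 \<cdot>\<^bsub>C\<^esub> p), \<Phi>\<^sub>1 n (r\<^sub>1 \<cdot>\<^bsub>C\<^esub> p)) (\<Phi>\<^sub>1 n t\<^sub>0, \<Phi>\<^sub>1 n t\<^sub>1)"
      using rel_le_image[OF V(1) rel(3)] \<open>rel_le C ?V T\<close> e by blast
    ultimately show "rel_holds E (\<Phi>\<^sub>1 n t\<^sub>0, \<Phi>\<^sub>1 n t\<^sub>1) (\<Phi>\<^sub>1 n y) (\<Phi>\<^sub>1 n y')"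
      using E[unfolded shifting_lemma_def, rule_format, of "\<Phi>\<^sub>0 n X" "(\<Phi>\<^sub>1 n r\<^sub>0, \<Phi>\<^sub>1 n r\<^sub>1)"
          "(\<Phi>\<^sub>1 n s\<^sub>0, \<Phi>\<^sub>1 n s\<^sub>1)" "(\<Phi>\<^sub>1 n t\<^sub>0, \<Phi>\<^sub>1 n t\<^sub>1)" _ "\<Phi>\<^sub>0 n U" "\<Phi>\<^sub>1 n x" "\<Phi>\<^sub>1 n y" "\<Phi>\<^sub>1 n x'" "\<Phi>\<^sub>1 n y'"]
        RST[unfolded e, THEN equivalence_relation_image, of n] E.Hom_Ob[OF \<Phi>_Hom[OF xy(1)]]
        \<Phi>_Hom[OF xy(1)] \<Phi>_Hom[OF xy(2)] \<Phi>_Hom[OF xy(3)] \<Phi>_Hom[OF xy(4)]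
        rel_holds_image[OF rel(2) xy(1) hyps(1)[unfolded e]]
        rel_holds_image[OF rel(2) xy(3) hyps(2)[unfolded e]]
        rel_holds_image[OF rel(1) xy(1) hyps(3)[unfolded e]]
        rel_holds_image[OF rel(1) xy(2) hyps(4)[unfolded e]]
        rel_holds_image[OF rel(3) xy(1) hyps(5)[unfolded e]]
      by blast
  qed
qed

end

section \<open>Internal categories in terms of generalized elements\<close>

definition composable :: "('o, 'm) cat \<Rightarrow> ('o, 'm) icat \<Rightarrow> 'o \<Rightarrow> 'm \<Rightarrow> 'm \<Rightarrow> bool" where
  "composable \<E> X U g f \<longleftrightarrow>
     g \<in> Hom \<E> U (X1 X) \<and> f \<in> Hom \<E> U (X1 X) \<and> src X \<cdot>\<^bsub>\<E>\<^esub> g = tgt X \<cdot>\<^bsub>\<E>\<^esub> f"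

definition icomp :: "('o, 'm) cat \<Rightarrow> ('o, 'm) icat \<Rightarrow> 'm \<Rightarrow> 'm \<Rightarrow> 'm" where
  "icomp \<E> X g f = mult X \<cdot>\<^bsub>\<E>\<^esub> ipair \<E> X g f"

text \<open>An internal category without unit and associativity laws. The calculus of composition
  developed here must already be available for the limit object, since it serves to prove those laws
  for it.\<close>

locale internal_magmoid = category \<E> for \<E> :: "('o, 'm) cat" (structure) +
  fixes X :: "('o, 'm) icat"
  assumes src_in_Hom: "src X \<in> Hom \<E> (X1 X) (X0 X)"
    and tgt_in_Hom: "tgt X \<in> Hom \<E> (X1 X) (X0 X)"
    and unt_in_Hom: "unt X \<in> Hom \<E> (X0 X) (X1 X)"
    and mult_in_Hom: "mult X \<in> Hom \<E> (X2 X) (X1 X)"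
    and X2_pullback: "is_pullback \<E> (X2 X) (prl X) (prr X) (src X) (tgt X)"
    and src_unt: "src X \<cdot> unt X = Idn \<E> (X0 X)"
    and tgt_unt: "tgt X \<cdot> unt X = Idn \<E> (X0 X)"
    and src_mult: "src X \<cdot> mult X = src X \<cdot> prr X"
    and tgt_mult: "tgt X \<cdot> mult X = tgt X \<cdot> prl X"
begin

section \<open>Pairing and composition of generalized elements\<close>

lemma prl_in_Hom: "prl X \<in> Hom \<E> (X2 X) (X1 X)"
  and prr_in_Hom: "prr X \<in> Hom \<E> (X2 X) (X1 X)"
  and src_prl: "src X \<cdot> prl X = tgt X \<cdot> prr X"
  and pair_ex1: "composable \<E> X U g f \<Longrightarrow>
    \<exists>!h. h \<in> Hom \<E> U (X2 X) \<and> prl X \<cdot> h = g \<and> prr X \<cdot> h = f"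
proof -
  have "Dom \<E> (src X) = X1 X" "Dom \<E> (tgt X) = X1 X"
    using src_in_Hom tgt_in_Hom by (simp_all add: Hom_def)
  note pb = X2_pullback[unfolded is_pullback_def this]
  show "prl X \<in> Hom \<E> (X2 X) (X1 X)" "prr X \<in> Hom \<E> (X2 X) (X1 X)"
    "src X \<cdot> prl X = tgt X \<cdot> prr X" using pb by blast+
  show "composable \<E> X U g f \<Longrightarrow> \<exists>!h. h \<in> Hom \<E> U (X2 X) \<and> prl X \<cdot> h = g \<and> prr X \<cdot> h = f"
    using pb Hom_Ob unfolding composable_def by blast
qed

lemma
  assumes c: "composable \<E> X U g f"
  shows ipair_in_Hom: "ipair \<E> X g f \<in> Hom \<E> U (X2 X)"
    and prl_ipair: "prl X \<cdot> ipair \<E> X g f = g"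
    and prr_ipair: "prr X \<cdot> ipair \<E> X g f = f"
proof -
  \<comment> \<open>The description in \<open>ipair\<close> takes its domain from the second
    argument, so this must be identified with \<open>U\<close> before unique existence
    applies.\<close>
  have "Dom \<E> f = U" using c by (simp add: composable_def Hom_def)
  then have "ipair \<E> X g f \<in> Hom \<E> U (X2 X) \<and>
      prl X \<cdot> ipair \<E> X g f = g \<and> prr X \<cdot> ipair \<E> X g f = f"
    using theI'[OF pair_ex1[OF c]] by (simp add: ipair_def)
  then show "ipair \<E> X g f \<in> Hom \<E> U (X2 X)" "prl X \<cdot> ipair \<E> X g f = g"
    "prr X \<cdot> ipair \<E> X g f = f" by simp_all
qed

lemma ipair_unique:
  "composable \<E> X U g f \<Longrightarrow> h \<in> Hom \<E> U (X2 X) \<Longrightarrow> prl X \<cdot> h = g \<Longrightarrow> prr X \<cdot> h = f \<Longrightarrow>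
    ipair \<E> X g f = h"
  using pair_ex1 ipair_in_Hom prl_ipair prr_ipair by blast

lemma composable_Cmp:
  assumes c: "composable \<E> X U g f" and k: "k \<in> Hom \<E> V U"
  shows "composable \<E> X V (g \<cdot> k) (f \<cdot> k)"
  using c k Cmp_in_Hom Cmp_eq_Cmp[OF _ k _ src_in_Hom _ tgt_in_Hom]
  unfolding composable_def by blast

lemma ipair_Cmp:
  assumes c: "composable \<E> X U g f" and k: "k \<in> Hom \<E> V U"
  shows "ipair \<E> X g f \<cdot> k = ipair \<E> X (g \<cdot> k) (f \<cdot> k)"
  using ipair_unique[OF composable_Cmp[OF c k], of "ipair \<E> X g f \<cdot> k"]
    Cmp_in_Hom[OF k ipair_in_Hom[OF c]]
    Cmp_eq_single[OF prl_ipair[OF c] k ipair_in_Hom[OF c] prl_in_Hom]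
    Cmp_eq_single[OF prr_ipair[OF c] k ipair_in_Hom[OF c] prr_in_Hom] by simp

lemma icomp_in_Hom:
  assumes c: "composable \<E> X U g f"
  shows "icomp \<E> X g f \<in> Hom \<E> U (X1 X)"
  using Cmp_in_Hom[OF ipair_in_Hom[OF c] mult_in_Hom] by (simp add: icomp_def)

lemma src_icomp:
  assumes c: "composable \<E> X U g f"
  shows "src X \<cdot> icomp \<E> X g f = src X \<cdot> f"
  using Cmp_eq_Cmp[OF src_mult ipair_in_Hom[OF c] mult_in_Hom src_in_Hom prr_in_Hom src_in_Hom]
    prr_ipair[OF c] by (simp add: icomp_def)

lemma tgt_icomp:
  assumes c: "composable \<E> X U g f"
  shows "tgt X \<cdot> icomp \<E> X g f = tgt X \<cdot> g"
  using Cmp_eq_Cmp[OF tgt_mult ipair_in_Hom[OF c] mult_in_Hom tgt_in_Hom prl_in_Hom tgt_in_Hom]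
    prl_ipair[OF c] by (simp add: icomp_def)

lemma icomp_Cmp:
  assumes c: "composable \<E> X U g f" and k: "k \<in> Hom \<E> V U"
  shows "icomp \<E> X g f \<cdot> k = icomp \<E> X (g \<cdot> k) (f \<cdot> k)"
  using Cmp_assoc[OF k ipair_in_Hom[OF c] mult_in_Hom] ipair_Cmp[OF c k] by (simp add: icomp_def)

lemma composable_pr:
  assumes h: "h \<in> Hom \<E> U (X2 X)"
  shows "composable \<E> X U (prl X \<cdot> h) (prr X \<cdot> h)"
  using Cmp_in_Hom[OF h prl_in_Hom] Cmp_in_Hom[OF h prr_in_Hom]
    Cmp_eq_Cmp[OF src_prl h prl_in_Hom src_in_Hom prr_in_Hom tgt_in_Hom]
  by (simp add: composable_def)

text \<open>Every generalized element of \<open>X2\<close> is the pairing of its two projections, so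
  \<open>mult\<close> is known once \<open>icomp\<close> is.\<close>

lemma mult_eq_icomp:
  assumes h: "h \<in> Hom \<E> U (X2 X)"
  shows "mult X \<cdot> h = icomp \<E> X (prl X \<cdot> h) (prr X \<cdot> h)"
  using ipair_unique[OF composable_pr[OF h] h] by (simp add: icomp_def)

lemma src_unt_Cmp: "x \<in> Hom \<E> U (X0 X) \<Longrightarrow> src X \<cdot> (unt X \<cdot> x) = x"
  and tgt_unt_Cmp: "x \<in> Hom \<E> U (X0 X) \<Longrightarrow> tgt X \<cdot> (unt X \<cdot> x) = x"
  using Cmp_eq_single[OF src_unt _ unt_in_Hom src_in_Hom]
    Cmp_eq_single[OF tgt_unt _ unt_in_Hom tgt_in_Hom] Cmp_Idn_left by metis+

lemma
  assumes g: "g \<in> Hom \<E> U (X1 X)"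
  shows composable_unt_right: "composable \<E> X U g (unt X \<cdot> (src X \<cdot> g))"
    and composable_unt_left: "composable \<E> X U (unt X \<cdot> (tgt X \<cdot> g)) g"
proof -
  note s = Cmp_in_Hom[OF g src_in_Hom] and t = Cmp_in_Hom[OF g tgt_in_Hom]
  show "composable \<E> X U g (unt X \<cdot> (src X \<cdot> g))" "composable \<E> X U (unt X \<cdot> (tgt X \<cdot> g)) g"
    using g Cmp_in_Hom[OF s unt_in_Hom] Cmp_in_Hom[OF t unt_in_Hom] tgt_unt_Cmp[OF s]
      src_unt_Cmp[OF t] by (simp_all add: composable_def)
qed

lemma composable_icomp:
  assumes "composable \<E> X U h g" "composable \<E> X U g f"
  shows "composable \<E> X U (icomp \<E> X h g) f" "composable \<E> X U h (icomp \<E> X g f)"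
  using assms icomp_in_Hom[OF assms(1)] icomp_in_Hom[OF assms(2)] src_icomp[OF assms(1)]
    tgt_icomp[OF assms(2)] by (simp_all add: composable_def)

text \<open>The axioms are instances of the elementwise laws at generic elements: the identity of
  \<open>X1 X\<close> for the unit laws, and for associativity the triple of arrows carried by a
  pullback \<open>X3\<close>.\<close>

lemma internal_categoryI:
  assumes right: "\<And>U g. g \<in> Hom \<E> U (X1 X) \<Longrightarrow> icomp \<E> X g (unt X \<cdot> (src X \<cdot> g)) = g"
    and left: "\<And>U g. g \<in> Hom \<E> U (X1 X) \<Longrightarrow> icomp \<E> X (unt X \<cdot> (tgt X \<cdot> g)) g = g"
    and assoc: "\<And>U h g f. composable \<E> X U h g \<Longrightarrow> composable \<E> X U g f \<Longrightarrow>
      icomp \<E> X (icomp \<E> X h g) f = icomp \<E> X h (icomp \<E> X g f)"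
  shows "internal_category \<E> X"
proof
  have X: "X0 X \<in> Ob \<E>" "X1 X \<in> Ob \<E>" "X2 X \<in> Ob \<E>"
    using Hom_Ob[OF src_in_Hom] Hom_Ob[OF mult_in_Hom] by auto
  then show "X0 X \<in> Ob \<E>" "X1 X \<in> Ob \<E>" "X2 X \<in> Ob \<E>" .
  show "mult X \<cdot> ipair \<E> X (Idn \<E> (X1 X)) (unt X \<cdot> src X) = Idn \<E> (X1 X)"
    using right[OF Idn_in_Hom[OF X(2)]] Cmp_Idn_right[OF src_in_Hom] by (simp add: icomp_def)
  show "mult X \<cdot> ipair \<E> X (unt X \<cdot> tgt X) (Idn \<E> (X1 X)) = Idn \<E> (X1 X)"
    using left[OF Idn_in_Hom[OF X(2)]] Cmp_Idn_right[OF tgt_in_Hom] by (simp add: icomp_def)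
  fix X3 u v assume pb: "is_pullback \<E> X3 u v (prr X) (prl X)"
  have uv: "u \<in> Hom \<E> X3 (X2 X)" "v \<in> Hom \<E> X3 (X2 X)" "prr X \<cdot> u = prl X \<cdot> v"
    using pb prl_in_Hom prr_in_Hom by (auto simp: is_pullback_def Hom_def)
  show "mult X \<cdot> ipair \<E> X (mult X \<cdot> u) (prr X \<cdot> v) = mult X \<cdot> ipair \<E> X (prl X \<cdot> u) (mult X \<cdot> v)"
    using assoc[OF composable_pr[OF uv(1)], of "prr X \<cdot> v"] composable_pr[OF uv(2)]
    unfolding mult_eq_icomp[OF uv(1)] mult_eq_icomp[OF uv(2)] uv(3) icomp_def by simp
qed (fact src_in_Hom tgt_in_Hom unt_in_Hom mult_in_Hom X2_pullback src_unt tgt_unt src_mult tgt_mult)+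

end

locale lex_category = category \<E> for \<E> :: "('o, 'm) cat" (structure) +
  assumes finitely_complete: "finitely_complete \<E>"
begin

lemma pullback_exists:
  assumes "f \<in> Hom \<E> A B" "g \<in> Hom \<E> D B"
  shows "\<exists>P p q. is_pullback \<E> P p q f g"
proof -
  obtain D\<^sub>0 D\<^sub>1 where D: "cat_functor kite \<E> D\<^sub>0 D\<^sub>1" and
    [simp]: "D\<^sub>1 4 = f" "D\<^sub>1 5 = f" "D\<^sub>1 6 = g" "D\<^sub>1 7 = g"
    by (rule cat_functor_kite[OF assms(1,1,2,2)])
  obtain L l where "is_limit kite \<E> D\<^sub>0 D\<^sub>1 L l"
    using finitely_complete D category_kite finite_kite unfolding finitely_complete_def by blast
  then have "is_double_pullback \<E> L (l 0) (l 1) (f, f) (g, g)" using limit_kite[OF _ D] by simp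
  then have "is_pullback \<E> L (l 0) (l 1) f g"
    using assms unfolding is_double_pullback_def is_pullback_def by (simp add: Hom_def)
  then show ?thesis by blast
qed

end

locale internal_category_in = lex_category \<E> + internal_magmoid \<E> X + internal_category \<E> X
  for \<E> :: "('o, 'm) cat" (structure) and X :: "('o, 'm) icat"
begin

text \<open>The axiom is the case of the identity of \<open>X1 X\<close>; composing it with
  \<open>g\<close> gives the general case, because \<open>icomp\<close> commutes with
  precomposition.\<close>

lemma icomp_unt_right:
  assumes g: "g \<in> Hom \<E> U (X1 X)"
  shows "icomp \<E> X g (unt X \<cdot> (src X \<cdot> g)) = g"
proof -
  have c: "composable \<E> X (X1 X) (Idn \<E> (X1 X)) (unt X \<cdot> src X)"
    using composable_unt_right[OF Idn_in_Hom[OF X1_in_Ob]] Cmp_Idn_right[OF src_in_Hom] by simp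
  have "icomp \<E> X (Idn \<E> (X1 X)) (unt X \<cdot> src X) = Idn \<E> (X1 X)"
    using mult_unt_right by (simp add: icomp_def)
  then show ?thesis
    using icomp_Cmp[OF c g] Cmp_Idn_left[OF g] Cmp_assoc[OF g src_in_Hom unt_in_Hom] by simp
qed

lemma icomp_unt_left:
  assumes g: "g \<in> Hom \<E> U (X1 X)"
  shows "icomp \<E> X (unt X \<cdot> (tgt X \<cdot> g)) g = g"
proof -
  have c: "composable \<E> X (X1 X) (unt X \<cdot> tgt X) (Idn \<E> (X1 X))"
    using composable_unt_left[OF Idn_in_Hom[OF X1_in_Ob]] Cmp_Idn_right[OF tgt_in_Hom] by simp
  have "icomp \<E> X (unt X \<cdot> tgt X) (Idn \<E> (X1 X)) = Idn \<E> (X1 X)"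
    using mult_unt_left by (simp add: icomp_def)
  then show ?thesis
    using icomp_Cmp[OF c g] Cmp_Idn_left[OF g] Cmp_assoc[OF g tgt_in_Hom unt_in_Hom] by simp
qed

text \<open>The axiom speaks of a given object of composable triples. Finite completeness supplies
  such an \<open>X3\<close>; the triple \<open>(h, g, f)\<close> factors through it by some
  \<open>k\<close>, and the axiom is restricted along \<open>k\<close>.\<close>

lemma icomp_assoc:
  assumes hg: "composable \<E> X U h g" and gf: "composable \<E> X U g f"
  shows "icomp \<E> X (icomp \<E> X h g) f = icomp \<E> X h (icomp \<E> X g f)"
proof -
  obtain X3 u v where pb: "is_pullback \<E> X3 u v (prr X) (prl X)"
    using pullback_exists[OF prr_in_Hom prl_in_Hom] by blast
  have "Dom \<E> (prr X) = X2 X" "Dom \<E> (prl X) = X2 X"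
    using prl_in_Hom prr_in_Hom by (simp_all add: Hom_def)
  note pb' = pb[unfolded is_pullback_def this]
  have uv: "u \<in> Hom \<E> X3 (X2 X)" "v \<in> Hom \<E> X3 (X2 X)" "prr X \<cdot> u = prl X \<cdot> v"
    using pb' by blast+
  have "U \<in> Ob \<E>" using Hom_Ob hg unfolding composable_def by blast
  moreover have "prr X \<cdot> ipair \<E> X h g = prl X \<cdot> ipair \<E> X g f"
    using prr_ipair[OF hg] prl_ipair[OF gf] by simp
  ultimately obtain k where k: "k \<in> Hom \<E> U X3" "u \<cdot> k = ipair \<E> X h g" "v \<cdot> k = ipair \<E> X g f"
    using pb' ipair_in_Hom[OF hg] ipair_in_Hom[OF gf] by blast
  note cu = composable_pr[OF uv(1)] and cv = composable_pr[OF uv(2)]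
  have e: "(prl X \<cdot> u) \<cdot> k = h" "(prl X \<cdot> v) \<cdot> k = g" "(prr X \<cdot> v) \<cdot> k = f"
    using Cmp_assoc[OF k(1) uv(1) prl_in_Hom] Cmp_assoc[OF k(1) uv(2) prl_in_Hom]
      Cmp_assoc[OF k(1) uv(2) prr_in_Hom] k prl_ipair[OF hg] prl_ipair[OF gf] prr_ipair[OF gf]
    by simp_all
  have cu': "composable \<E> X X3 (prl X \<cdot> u) (prl X \<cdot> v)" using cu uv(3) by simp
  have mu: "mult X \<cdot> u = icomp \<E> X (prl X \<cdot> u) (prl X \<cdot> v)"
    and mv: "mult X \<cdot> v = icomp \<E> X (prl X \<cdot> v) (prr X \<cdot> v)"
    using mult_eq_icomp[OF uv(1)] mult_eq_icomp[OF uv(2)] uv(3) by simp_all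
  have "icomp \<E> X (icomp \<E> X (prl X \<cdot> u) (prl X \<cdot> v)) (prr X \<cdot> v) =
      icomp \<E> X (prl X \<cdot> u) (icomp \<E> X (prl X \<cdot> v) (prr X \<cdot> v))"
    using mult_assoc[OF pb] unfolding mu mv by (simp add: icomp_def)
  then have "icomp \<E> X (icomp \<E> X (prl X \<cdot> u) (prl X \<cdot> v)) (prr X \<cdot> v) \<cdot> k =
      icomp \<E> X (prl X \<cdot> u) (icomp \<E> X (prl X \<cdot> v) (prr X \<cdot> v)) \<cdot> k" by simp
  then show ?thesis
    unfolding icomp_Cmp[OF composable_icomp(1)[OF cu' cv] k(1)]
      icomp_Cmp[OF composable_icomp(2)[OF cu' cv] k(1)]
      icomp_Cmp[OF cu' k(1)] icomp_Cmp[OF cv k(1)] e .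
qed

text \<open>The usual computation that a left inverse \<open>a\<close> and a right inverse
  \<open>b\<close> of \<open>f\<close> agree, via a(fb) = (af)b. It is applied to show that functors
  commute with inversion.\<close>

lemma inverse_unique:
  assumes af: "composable \<E> X U a f" and fb: "composable \<E> X U f b"
    and a: "icomp \<E> X a f = unt X \<cdot> (src X \<cdot> f)" and b: "icomp \<E> X f b = unt X \<cdot> (tgt X \<cdot> f)"
  shows "a = b"
proof -
  have src_a: "src X \<cdot> a = tgt X \<cdot> f" and tgt_b: "tgt X \<cdot> b = src X \<cdot> f"
    and aH: "a \<in> Hom \<E> U (X1 X)" and bH: "b \<in> Hom \<E> U (X1 X)"
    using af fb by (simp_all add: composable_def)
  have "a = icomp \<E> X a (icomp \<E> X f b)" using icomp_unt_right[OF aH] b src_a by simp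
  also have "\<dots> = icomp \<E> X (icomp \<E> X a f) b" using icomp_assoc[OF af fb] by simp
  also have "\<dots> = b" using icomp_unt_left[OF bH] a tgt_b by simp
  finally show ?thesis .
qed

end

context lex_category
begin

lemma internal_category_in:
  assumes "internal_category \<E> X"
  shows "internal_category_in \<E> X"
proof -
  interpret X: internal_category \<E> X by fact
  show ?thesis
    by unfold_locales (fact X.src_in_Hom X.tgt_in_Hom X.unt_in_Hom X.mult_in_Hom X.X2_pullback
        X.src_unt X.tgt_unt X.src_mult X.tgt_mult)+
qed

text \<open>Preservation of \<open>mult\<close> is preservation of composition at the generic
  composable pair, and precomposition spreads it to all pairs. Composability of the images is
  recorded too: without it the pairing in the target would be an unspecified description.\<close>

lemma internal_functor_iff:
  "internal_functor \<E> F \<longleftrightarrow>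
    internal_category \<E> (fdom F) \<and> internal_category \<E> (fcod F) \<and>
    F0 F \<in> Hom \<E> (X0 (fdom F)) (X0 (fcod F)) \<and> F1 F \<in> Hom \<E> (X1 (fdom F)) (X1 (fcod F)) \<and>
    src (fcod F) \<cdot> F1 F = F0 F \<cdot> src (fdom F) \<and>
    tgt (fcod F) \<cdot> F1 F = F0 F \<cdot> tgt (fdom F) \<and>
    F1 F \<cdot> unt (fdom F) = unt (fcod F) \<cdot> F0 F \<and>
    (\<forall>U g f. composable \<E> (fdom F) U g f \<longrightarrow>
      composable \<E> (fcod F) U (F1 F \<cdot> g) (F1 F \<cdot> f) \<and>
      F1 F \<cdot> icomp \<E> (fdom F) g f = icomp \<E> (fcod F) (F1 F \<cdot> g) (F1 F \<cdot> f))"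
    (is "_ \<longleftrightarrow> ?cat \<and> ?cat' \<and> ?F0 \<and> ?F1 \<and> ?src \<and> ?tgt \<and> ?unt \<and> ?comp")
proof -
  let ?X = "fdom F" and ?Y = "fcod F"
  have "F1 F \<cdot> mult ?X = mult ?Y \<cdot> ipair \<E> ?Y (F1 F \<cdot> prl ?X) (F1 F \<cdot> prr ?X) \<longleftrightarrow> ?comp"
    (is "?mult \<longleftrightarrow> _")
    if "?cat" "?cat'" and F: "?F0" "?F1" and st: "?src" "?tgt"
  proof -
    interpret X: internal_category_in \<E> ?X using internal_category_in that(1) .
    interpret Y: internal_category_in \<E> ?Y using internal_category_in that(2) .
    have c: "composable \<E> ?Y U (F1 F \<cdot> g) (F1 F \<cdot> f)" if "composable \<E> ?X U g f" for U g f
    proof -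
      have g: "g \<in> Hom \<E> U (X1 ?X)" and f: "f \<in> Hom \<E> U (X1 ?X)"
        and e: "src ?X \<cdot> g = tgt ?X \<cdot> f" using that by (simp_all add: composable_def)
      show ?thesis
        using Cmp_eq_Cmp[OF st(1) g F(2) Y.src_in_Hom X.src_in_Hom F(1)]
          Cmp_eq_Cmp[OF st(2) f F(2) Y.tgt_in_Hom X.tgt_in_Hom F(1)] e
          Cmp_in_Hom[OF g F(2)] Cmp_in_Hom[OF f F(2)] by (simp add: composable_def)
    qed
    \<comment> \<open>The generic composable pair: every other one is obtained from it by composing
      with its pairing, and its own composite is \<open>mult\<close>.\<close>
    have pr: "composable \<E> ?X (X2 ?X) (prl ?X) (prr ?X)"
      using X.prl_in_Hom X.prr_in_Hom X.src_prl by (simp add: composable_def)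
    have "F1 F \<cdot> icomp \<E> ?X g f = icomp \<E> ?Y (F1 F \<cdot> g) (F1 F \<cdot> f)"
      if m: "?mult" and gf: "composable \<E> ?X U g f" for U g f
    proof -
      note p = X.ipair_in_Hom[OF gf]
      have "F1 F \<cdot> icomp \<E> ?X g f = icomp \<E> ?Y (F1 F \<cdot> prl ?X) (F1 F \<cdot> prr ?X) \<cdot> ipair \<E> ?X g f"
        using Cmp_eq_single[OF m p X.mult_in_Hom F(2)] by (simp add: icomp_def)
      also have "\<dots> = icomp \<E> ?Y (F1 F \<cdot> g) (F1 F \<cdot> f)"
        using Y.icomp_Cmp[OF c[OF pr] p] Cmp_assoc[OF p X.prl_in_Hom F(2)]
          Cmp_assoc[OF p X.prr_in_Hom F(2)] X.prl_ipair[OF gf] X.prr_ipair[OF gf] by simp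
      finally show ?thesis .
    qed
    moreover have "?mult" if "?comp"
    proof -
      have "icomp \<E> ?X (prl ?X) (prr ?X) = mult ?X"
        using X.mult_eq_icomp[OF Idn_in_Hom[OF X.X2_in_Ob]] Cmp_Idn_right[OF X.mult_in_Hom]
          Cmp_Idn_right[OF X.prl_in_Hom] Cmp_Idn_right[OF X.prr_in_Hom] by simp
      moreover have "F1 F \<cdot> icomp \<E> ?X (prl ?X) (prr ?X) =
          icomp \<E> ?Y (F1 F \<cdot> prl ?X) (F1 F \<cdot> prr ?X)" using that pr by blast
      ultimately show ?thesis by (simp add: icomp_def)
    qed
    ultimately show ?thesis using c by blast
  qed
  then show ?thesis unfolding internal_functor_def Let_def by blast
qed

end

section \<open>Levelwise limits of internal categories\<close>

definition functor_between ::
  "('o, 'm) cat \<Rightarrow> ('o, 'm) icat \<Rightarrow> ('o, 'm) icat \<Rightarrow> ('o, 'm) ifun \<Rightarrow> bool" where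
  "functor_between \<E> X Y F \<longleftrightarrow> internal_functor \<E> F \<and> fdom F = X \<and> fcod F = Y"

text \<open>The index set is arbitrary so that the notion covers both the projections of a limit and
  the two legs of a relation, indexed by the truth values.\<close>

definition jointly_monic :: "('o, 'm) cat \<Rightarrow> 'i set \<Rightarrow> 'o \<Rightarrow> ('i \<Rightarrow> 'm) \<Rightarrow> bool" where
  "jointly_monic \<E> I L l \<longleftrightarrow> (\<forall>V. \<forall>h\<in>Hom \<E> V L. \<forall>k\<in>Hom \<E> V L.
     (\<forall>i\<in>I. l i \<cdot>\<^bsub>\<E>\<^esub> h = l i \<cdot>\<^bsub>\<E>\<^esub> k) \<longrightarrow> h = k)"

lemma jointly_monicD:
  "jointly_monic \<E> I L l \<Longrightarrow> h \<in> Hom \<E> V L \<Longrightarrow> k \<in> Hom \<E> V L \<Longrightarrow>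
    (\<And>i. i \<in> I \<Longrightarrow> l i \<cdot>\<^bsub>\<E>\<^esub> h = l i \<cdot>\<^bsub>\<E>\<^esub> k) \<Longrightarrow> h = k"
  unfolding jointly_monic_def by blast

lemma (in category) limit_jointly_monic:
  assumes "is_limit J C D\<^sub>0 D\<^sub>1 L l" "category J" "cat_functor J C D\<^sub>0 D\<^sub>1"
  shows "jointly_monic C (Ob J) L l"
  unfolding jointly_monic_def using limit_joint_mono[OF assms] by blast

context lex_category
begin

section \<open>Internal functors, described by their action on generalized elements\<close>

lemma functor_betweenI:
  assumes "internal_category \<E> X" "internal_category \<E> Y"
    and "f\<^sub>0 \<in> Hom \<E> (X0 X) (X0 Y)" "f\<^sub>1 \<in> Hom \<E> (X1 X) (X1 Y)"
    and "src Y \<cdot> f\<^sub>1 = f\<^sub>0 \<cdot> src X" "tgt Y \<cdot> f\<^sub>1 = f\<^sub>0 \<cdot> tgt X" "f\<^sub>1 \<cdot> unt X = unt Y \<cdot> f\<^sub>0"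
    and "\<And>U g f. composable \<E> X U g f \<Longrightarrow> composable \<E> Y U (f\<^sub>1 \<cdot> g) (f\<^sub>1 \<cdot> f) \<and>
      f\<^sub>1 \<cdot> icomp \<E> X g f = icomp \<E> Y (f\<^sub>1 \<cdot> g) (f\<^sub>1 \<cdot> f)"
  shows "functor_between \<E> X Y \<lparr>fdom = X, fcod = Y, F0 = f\<^sub>0, F1 = f\<^sub>1\<rparr>"
  using assms unfolding functor_between_def internal_functor_iff by simp

lemma functor_betweenD:
  assumes "functor_between \<E> X Y F"
  shows "internal_category \<E> X" "internal_category \<E> Y"
    and "F0 F \<in> Hom \<E> (X0 X) (X0 Y)" "F1 F \<in> Hom \<E> (X1 X) (X1 Y)"
    and "src Y \<cdot> F1 F = F0 F \<cdot> src X" "tgt Y \<cdot> F1 F = F0 F \<cdot> tgt X" "F1 F \<cdot> unt X = unt Y \<cdot> F0 F"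
    and "composable \<E> X U g f \<Longrightarrow> composable \<E> Y U (F1 F \<cdot> g) (F1 F \<cdot> f)"
    and "composable \<E> X U g f \<Longrightarrow> F1 F \<cdot> icomp \<E> X g f = icomp \<E> Y (F1 F \<cdot> g) (F1 F \<cdot> f)"
  using assms unfolding functor_between_def internal_functor_iff by auto

lemma functor_src:
  assumes F: "functor_between \<E> X Y F" and g: "g \<in> Hom \<E> U (X1 X)"
  shows "F0 F \<cdot> (src X \<cdot> g) = src Y \<cdot> (F1 F \<cdot> g)" "F0 F \<cdot> (tgt X \<cdot> g) = tgt Y \<cdot> (F1 F \<cdot> g)"
proof -
  note D = functor_betweenD[OF F]
  interpret X: internal_category \<E> X by (fact D)
  interpret Y: internal_category \<E> Y by (fact D)
  show "F0 F \<cdot> (src X \<cdot> g) = src Y \<cdot> (F1 F \<cdot> g)" "F0 F \<cdot> (tgt X \<cdot> g) = tgt Y \<cdot> (F1 F \<cdot> g)"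
    using Cmp_eq_Cmp[OF D(5) g D(4) Y.src_in_Hom X.src_in_Hom D(3)]
      Cmp_eq_Cmp[OF D(6) g D(4) Y.tgt_in_Hom X.tgt_in_Hom D(3)] by simp_all
qed

lemma functor_unt:
  assumes F: "functor_between \<E> X Y F" and x: "x \<in> Hom \<E> U (X0 X)"
  shows "F1 F \<cdot> (unt X \<cdot> x) = unt Y \<cdot> (F0 F \<cdot> x)"
proof -
  note D = functor_betweenD[OF F]
  interpret X: internal_category \<E> X by (fact D)
  interpret Y: internal_category \<E> Y by (fact D)
  show ?thesis using Cmp_eq_Cmp[OF D(7) x X.unt_in_Hom D(4) D(3) Y.unt_in_Hom] .
qed

lemma functor_Idn:
  assumes X: "internal_category \<E> X"
  shows "functor_between \<E> X X \<lparr>fdom = X, fcod = X, F0 = Idn \<E> (X0 X), F1 = Idn \<E> (X1 X)\<rparr>"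
proof -
  interpret X: internal_category_in \<E> X using internal_category_in[OF X] .
  show ?thesis
  proof (rule functor_betweenI[OF X X Idn_in_Hom[OF X.X0_in_Ob] Idn_in_Hom[OF X.X1_in_Ob]])
    fix U g f assume c: "composable \<E> X U g f"
    then have "g \<in> Hom \<E> U (X1 X)" "f \<in> Hom \<E> U (X1 X)" by (simp_all add: composable_def)
    then show "composable \<E> X U (Idn \<E> (X1 X) \<cdot> g) (Idn \<E> (X1 X) \<cdot> f) \<and>
        Idn \<E> (X1 X) \<cdot> icomp \<E> X g f = icomp \<E> X (Idn \<E> (X1 X) \<cdot> g) (Idn \<E> (X1 X) \<cdot> f)"
      using c Cmp_Idn_left X.icomp_in_Hom[OF c] by metis
  qed (simp_all add: Cmp_Idn_left[OF X.src_in_Hom] Cmp_Idn_right[OF X.src_in_Hom]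
      Cmp_Idn_left[OF X.tgt_in_Hom] Cmp_Idn_right[OF X.tgt_in_Hom]
      Cmp_Idn_left[OF X.unt_in_Hom] Cmp_Idn_right[OF X.unt_in_Hom])
qed

lemma functor_Cmp:
  assumes F: "functor_between \<E> X Y F" and G: "functor_between \<E> Y Z G"
  shows "functor_between \<E> X Z \<lparr>fdom = X, fcod = Z, F0 = F0 G \<cdot> F0 F, F1 = F1 G \<cdot> F1 F\<rparr>"
proof -
  note F' = functor_betweenD[OF F] and G' = functor_betweenD[OF G]
  interpret X: internal_category_in \<E> X using internal_category_in[OF F'(1)] .
  interpret Y: internal_category_in \<E> Y using internal_category_in[OF F'(2)] .
  interpret Z: internal_category_in \<E> Z using internal_category_in[OF G'(2)] .
  show ?thesis
  proof (rule functor_betweenI[OF F'(1) G'(2) Cmp_in_Hom[OF F'(3) G'(3)] Cmp_in_Hom[OF F'(4) G'(4)]])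
    show "src Z \<cdot> (F1 G \<cdot> F1 F) = F0 G \<cdot> F0 F \<cdot> src X"
      using functor_src(1)[OF G F'(4)] F'(5) Cmp_assoc[OF X.src_in_Hom F'(3) G'(3)] by simp
    show "tgt Z \<cdot> (F1 G \<cdot> F1 F) = F0 G \<cdot> F0 F \<cdot> tgt X"
      using functor_src(2)[OF G F'(4)] F'(6) Cmp_assoc[OF X.tgt_in_Hom F'(3) G'(3)] by simp
    show "F1 G \<cdot> F1 F \<cdot> unt X = unt Z \<cdot> (F0 G \<cdot> F0 F)"
      using functor_unt[OF G F'(3)] F'(7) Cmp_assoc[OF X.unt_in_Hom F'(4) G'(4)] by simp
    fix U g f assume c: "composable \<E> X U g f"
    then have gf: "g \<in> Hom \<E> U (X1 X)" "f \<in> Hom \<E> U (X1 X)" by (simp_all add: composable_def)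
    show "composable \<E> Z U (F1 G \<cdot> F1 F \<cdot> g) (F1 G \<cdot> F1 F \<cdot> f) \<and>
        F1 G \<cdot> F1 F \<cdot> icomp \<E> X g f = icomp \<E> Z (F1 G \<cdot> F1 F \<cdot> g) (F1 G \<cdot> F1 F \<cdot> f)"
      using Cmp_assoc[OF gf(1) F'(4) G'(4)] Cmp_assoc[OF gf(2) F'(4) G'(4)]
        Cmp_assoc[OF X.icomp_in_Hom[OF c] F'(4) G'(4)] F'(9)[OF c] G'(8)[OF F'(8)[OF c]]
        G'(9)[OF F'(8)[OF c]] by simp
  qed
qed

text \<open>Each functor equation for \<open>h\<^sub>0\<close> and \<open>h\<^sub>1\<close> is
  tested after composing with the \<open>l i\<close>, where it becomes the same equation for
  \<open>u i\<close>. It serves twice: for the mediating functor into a limit, and for the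
  factorization through a relation.\<close>

lemma functor_lift:
  assumes U: "internal_category \<E> U" and L: "internal_category \<E> L"
    and l: "\<And>i. i \<in> I \<Longrightarrow> functor_between \<E> L (D i) (l i)"
    and u: "\<And>i. i \<in> I \<Longrightarrow> functor_between \<E> U (D i) (u i)"
    and mono: "jointly_monic \<E> I (X0 L) (\<lambda>i. F0 (l i))" "jointly_monic \<E> I (X1 L) (\<lambda>i. F1 (l i))"
    and h\<^sub>0: "h\<^sub>0 \<in> Hom \<E> (X0 U) (X0 L)" and h\<^sub>1: "h\<^sub>1 \<in> Hom \<E> (X1 U) (X1 L)"
    and eq: "\<And>i. i \<in> I \<Longrightarrow> F0 (l i) \<cdot> h\<^sub>0 = F0 (u i)" "\<And>i. i \<in> I \<Longrightarrow> F1 (l i) \<cdot> h\<^sub>1 = F1 (u i)"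
  shows "functor_between \<E> U L \<lparr>fdom = U, fcod = L, F0 = h\<^sub>0, F1 = h\<^sub>1\<rparr>"
proof -
  interpret U: internal_category_in \<E> U using internal_category_in[OF U] .
  interpret L: internal_category_in \<E> L using internal_category_in[OF L] .
  note lD = functor_betweenD[OF l] and uD = functor_betweenD[OF u]
  have src: "src L \<cdot> h\<^sub>1 = h\<^sub>0 \<cdot> src U"
  proof (rule jointly_monicD[OF mono(1) Cmp_in_Hom[OF h\<^sub>1 L.src_in_Hom] Cmp_in_Hom[OF U.src_in_Hom h\<^sub>0]])
    fix i assume i: "i \<in> I"
    show "F0 (l i) \<cdot> (src L \<cdot> h\<^sub>1) = F0 (l i) \<cdot> (h\<^sub>0 \<cdot> src U)"
      using functor_src(1)[OF l[OF i] h\<^sub>1] uD(5)[OF i] eq[OF i]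
        Cmp_assoc[OF U.src_in_Hom h\<^sub>0 lD(3)[OF i]] by simp
  qed
  have tgt: "tgt L \<cdot> h\<^sub>1 = h\<^sub>0 \<cdot> tgt U"
  proof (rule jointly_monicD[OF mono(1) Cmp_in_Hom[OF h\<^sub>1 L.tgt_in_Hom] Cmp_in_Hom[OF U.tgt_in_Hom h\<^sub>0]])
    fix i assume i: "i \<in> I"
    show "F0 (l i) \<cdot> (tgt L \<cdot> h\<^sub>1) = F0 (l i) \<cdot> (h\<^sub>0 \<cdot> tgt U)"
      using functor_src(2)[OF l[OF i] h\<^sub>1] uD(6)[OF i] eq[OF i]
        Cmp_assoc[OF U.tgt_in_Hom h\<^sub>0 lD(3)[OF i]] by simp
  qed
  show ?thesis
  proof (rule functor_betweenI[OF U L h\<^sub>0 h\<^sub>1 src tgt])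
    show "h\<^sub>1 \<cdot> unt U = unt L \<cdot> h\<^sub>0"
    proof (rule jointly_monicD[OF mono(2) Cmp_in_Hom[OF U.unt_in_Hom h\<^sub>1] Cmp_in_Hom[OF h\<^sub>0 L.unt_in_Hom]])
      fix i assume i: "i \<in> I"
      show "F1 (l i) \<cdot> (h\<^sub>1 \<cdot> unt U) = F1 (l i) \<cdot> (unt L \<cdot> h\<^sub>0)"
        using functor_unt[OF l[OF i] h\<^sub>0] uD(7)[OF i] eq[OF i]
          Cmp_assoc[OF U.unt_in_Hom h\<^sub>1 lD(4)[OF i]] by simp
    qed
    fix V g f assume c: "composable \<E> U V g f"
    then have gf: "g \<in> Hom \<E> V (X1 U)" "f \<in> Hom \<E> V (X1 U)" "src U \<cdot> g = tgt U \<cdot> f"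
      by (simp_all add: composable_def)
    have c': "composable \<E> L V (h\<^sub>1 \<cdot> g) (h\<^sub>1 \<cdot> f)"
      using Cmp_eq_Cmp[OF src gf(1) h\<^sub>1 L.src_in_Hom U.src_in_Hom h\<^sub>0]
        Cmp_eq_Cmp[OF tgt gf(2) h\<^sub>1 L.tgt_in_Hom U.tgt_in_Hom h\<^sub>0] gf(3)
        Cmp_in_Hom[OF gf(1) h\<^sub>1] Cmp_in_Hom[OF gf(2) h\<^sub>1] by (simp add: composable_def)
    have "h\<^sub>1 \<cdot> icomp \<E> U g f = icomp \<E> L (h\<^sub>1 \<cdot> g) (h\<^sub>1 \<cdot> f)"
    proof (rule jointly_monicD[OF mono(2) Cmp_in_Hom[OF U.icomp_in_Hom[OF c] h\<^sub>1] L.icomp_in_Hom[OF c']])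
      fix i assume i: "i \<in> I"
      have "F1 (l i) \<cdot> (h\<^sub>1 \<cdot> x) = F1 (u i) \<cdot> x" if "x \<in> Hom \<E> V (X1 U)" for x
        using Cmp_eq_single[OF eq(2)[OF i] that h\<^sub>1 lD(4)[OF i]] .
      then show "F1 (l i) \<cdot> (h\<^sub>1 \<cdot> icomp \<E> U g f) = F1 (l i) \<cdot> icomp \<E> L (h\<^sub>1 \<cdot> g) (h\<^sub>1 \<cdot> f)"
        using U.icomp_in_Hom[OF c] gf lD(9)[OF i c'] uD(9)[OF i c] by simp
    qed
    then show "composable \<E> L V (h\<^sub>1 \<cdot> g) (h\<^sub>1 \<cdot> f) \<and>
        h\<^sub>1 \<cdot> icomp \<E> U g f = icomp \<E> L (h\<^sub>1 \<cdot> g) (h\<^sub>1 \<cdot> f)" using c' by blast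
  qed
qed

end

text \<open>The diagram is described without mentioning a category of internal categories, so one
  limit construction serves \<open>Cat \<E>\<close> and \<open>Grd \<E>\<close>. Its two levels are
  required to be functors into \<E>, where limits can be taken.\<close>

locale internal_diagram = lex_category \<E> + J: category J
  for \<E> :: "('o, 'm) cat" (structure) and J :: "('i, 'j) cat" +
  fixes D\<^sub>0 :: "'i \<Rightarrow> ('o, 'm) icat" and D\<^sub>1 :: "'j \<Rightarrow> ('o, 'm) ifun"
  assumes D\<^sub>0: "i \<in> Ob J \<Longrightarrow> internal_category \<E> (D\<^sub>0 i)"
    and D\<^sub>1: "a \<in> Mor J \<Longrightarrow> functor_between \<E> (D\<^sub>0 (Dom J a)) (D\<^sub>0 (Cod J a)) (D\<^sub>1 a)"
    and level0: "cat_functor J \<E> (\<lambda>i. X0 (D\<^sub>0 i)) (\<lambda>a. F0 (D\<^sub>1 a))"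
    and level1: "cat_functor J \<E> (\<lambda>i. X1 (D\<^sub>0 i)) (\<lambda>a. F1 (D\<^sub>1 a))"
begin

text \<open>Nothing is demanded of \<open>X2\<close>: as a pullback it is determined up to
  isomorphism by the other data.\<close>

definition levelwise_limit :: "('o, 'm) icat \<Rightarrow> ('i \<Rightarrow> ('o, 'm) ifun) \<Rightarrow> bool" where
  "levelwise_limit L l \<longleftrightarrow>
     internal_category \<E> L \<and> (\<forall>i\<in>Ob J. functor_between \<E> L (D\<^sub>0 i) (l i)) \<and>
     is_limit J \<E> (\<lambda>i. X0 (D\<^sub>0 i)) (\<lambda>a. F0 (D\<^sub>1 a)) (X0 L) (\<lambda>i. F0 (l i)) \<and>
     is_limit J \<E> (\<lambda>i. X1 (D\<^sub>0 i)) (\<lambda>a. F1 (D\<^sub>1 a)) (X1 L) (\<lambda>i. F1 (l i))"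

lemma levelwise_limit_jointly_monic:
  assumes "levelwise_limit L l"
  shows "jointly_monic \<E> (Ob J) (X0 L) (\<lambda>i. F0 (l i))"
    and "jointly_monic \<E> (Ob J) (X1 L) (\<lambda>i. F1 (l i))"
  using assms limit_jointly_monic[OF _ J.category_axioms level0]
    limit_jointly_monic[OF _ J.category_axioms level1] unfolding levelwise_limit_def by blast+

text \<open>The structure morphisms of the diagram commute with the transition functors, so they
  induce structure on the limits of the two levels. The laws then hold because the projections are
  jointly monic and carry each law to the corresponding one in \<open>D\<^sub>0 i\<close>.\<close>

lemma levelwise_limit_exists:
  assumes lim0: "is_limit J \<E> (\<lambda>i. X0 (D\<^sub>0 i)) (\<lambda>a. F0 (D\<^sub>1 a)) L\<^sub>0 l\<^sub>0"
    and lim1: "is_limit J \<E> (\<lambda>i. X1 (D\<^sub>0 i)) (\<lambda>a. F1 (D\<^sub>1 a)) L\<^sub>1 l\<^sub>1"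
  shows "\<exists>L l. levelwise_limit L l"
proof -
  note mono0 = jointly_monicD[OF limit_jointly_monic[OF lim0 J.category_axioms level0]]
  note mono1 = jointly_monicD[OF limit_jointly_monic[OF lim1 J.category_axioms level1]]
  note l\<^sub>0 = limit_cone(2)[OF lim0] and l\<^sub>1 = limit_cone(2)[OF lim1]
  have D: "internal_category_in \<E> (D\<^sub>0 i)" if "i \<in> Ob J" for i
    using internal_category_in[OF D\<^sub>0[OF that]] .
  have mag: "internal_magmoid \<E> (D\<^sub>0 i)" if "i \<in> Ob J" for i
    using D[OF that] by (simp add: internal_category_in_def)
  note src_D = internal_magmoid.src_in_Hom[OF mag] and tgt_D = internal_magmoid.tgt_in_Hom[OF mag]
    and unt_D = internal_magmoid.unt_in_Hom[OF mag]
  obtain s where s: "s \<in> Hom \<E> L\<^sub>1 L\<^sub>0" and s_eq: "\<And>i. i \<in> Ob J \<Longrightarrow> l\<^sub>0 i \<cdot> s = src (D\<^sub>0 i) \<cdot> l\<^sub>1 i"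
  proof (rule limit_factor[OF lim0 limit_cone(1)[OF lim1], of "\<lambda>i. src (D\<^sub>0 i) \<cdot> l\<^sub>1 i"])
    show "src (D\<^sub>0 i) \<cdot> l\<^sub>1 i \<in> Hom \<E> L\<^sub>1 (X0 (D\<^sub>0 i))" if "i \<in> Ob J" for i
      using Cmp_in_Hom[OF l\<^sub>1[OF that] src_D[OF that]] .
    show "F0 (D\<^sub>1 a) \<cdot> (src (D\<^sub>0 (Dom J a)) \<cdot> l\<^sub>1 (Dom J a)) = src (D\<^sub>0 (Cod J a)) \<cdot> l\<^sub>1 (Cod J a)"
      if a: "a \<in> Mor J" for a
      using functor_src(1)[OF D\<^sub>1[OF a] l\<^sub>1[OF J.Dom_in_Ob[OF a]]] limit_cone(3)[OF lim1 a] by simp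
  qed blast
  obtain t where t: "t \<in> Hom \<E> L\<^sub>1 L\<^sub>0" and t_eq: "\<And>i. i \<in> Ob J \<Longrightarrow> l\<^sub>0 i \<cdot> t = tgt (D\<^sub>0 i) \<cdot> l\<^sub>1 i"
  proof (rule limit_factor[OF lim0 limit_cone(1)[OF lim1], of "\<lambda>i. tgt (D\<^sub>0 i) \<cdot> l\<^sub>1 i"])
    show "tgt (D\<^sub>0 i) \<cdot> l\<^sub>1 i \<in> Hom \<E> L\<^sub>1 (X0 (D\<^sub>0 i))" if "i \<in> Ob J" for i
      using Cmp_in_Hom[OF l\<^sub>1[OF that] tgt_D[OF that]] .
    show "F0 (D\<^sub>1 a) \<cdot> (tgt (D\<^sub>0 (Dom J a)) \<cdot> l\<^sub>1 (Dom J a)) = tgt (D\<^sub>0 (Cod J a)) \<cdot> l\<^sub>1 (Cod J a)"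
      if a: "a \<in> Mor J" for a
      using functor_src(2)[OF D\<^sub>1[OF a] l\<^sub>1[OF J.Dom_in_Ob[OF a]]] limit_cone(3)[OF lim1 a] by simp
  qed blast
  obtain e where e: "e \<in> Hom \<E> L\<^sub>0 L\<^sub>1" and e_eq: "\<And>i. i \<in> Ob J \<Longrightarrow> l\<^sub>1 i \<cdot> e = unt (D\<^sub>0 i) \<cdot> l\<^sub>0 i"
  proof (rule limit_factor[OF lim1 limit_cone(1)[OF lim0], of "\<lambda>i. unt (D\<^sub>0 i) \<cdot> l\<^sub>0 i"])
    show "unt (D\<^sub>0 i) \<cdot> l\<^sub>0 i \<in> Hom \<E> L\<^sub>0 (X1 (D\<^sub>0 i))" if "i \<in> Ob J" for i
      using Cmp_in_Hom[OF l\<^sub>0[OF that] unt_D[OF that]] .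
    show "F1 (D\<^sub>1 a) \<cdot> (unt (D\<^sub>0 (Dom J a)) \<cdot> l\<^sub>0 (Dom J a)) = unt (D\<^sub>0 (Cod J a)) \<cdot> l\<^sub>0 (Cod J a)"
      if a: "a \<in> Mor J" for a
      using functor_unt[OF D\<^sub>1[OF a] l\<^sub>0[OF J.Dom_in_Ob[OF a]]] limit_cone(3)[OF lim0 a] by simp
  qed blast
  have s_Cmp: "l\<^sub>0 i \<cdot> (s \<cdot> x) = src (D\<^sub>0 i) \<cdot> (l\<^sub>1 i \<cdot> x)"
    and t_Cmp: "l\<^sub>0 i \<cdot> (t \<cdot> x) = tgt (D\<^sub>0 i) \<cdot> (l\<^sub>1 i \<cdot> x)"
    if i: "i \<in> Ob J" and x: "x \<in> Hom \<E> V L\<^sub>1" for i V x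
    using Cmp_eq_Cmp[OF s_eq[OF i] x s l\<^sub>0[OF i] l\<^sub>1[OF i] src_D[OF i]]
      Cmp_eq_Cmp[OF t_eq[OF i] x t l\<^sub>0[OF i] l\<^sub>1[OF i] tgt_D[OF i]] by simp_all
  have e_Cmp: "l\<^sub>1 i \<cdot> (e \<cdot> x) = unt (D\<^sub>0 i) \<cdot> (l\<^sub>0 i \<cdot> x)"
    if i: "i \<in> Ob J" and x: "x \<in> Hom \<E> V L\<^sub>0" for i V x
    using Cmp_eq_Cmp[OF e_eq[OF i] x e l\<^sub>1[OF i] l\<^sub>0[OF i] unt_D[OF i]] .
  \<comment> \<open>No limit of the objects \<open>X2 (D\<^sub>0 i)\<close> is formed. Any pullback
    of \<open>s\<close> and \<open>t\<close> will do, since the projections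
    \<open>l\<^sub>1 i\<close> turn its generic pair into a composable pair of each
    \<open>D\<^sub>0 i\<close>.\<close>
  obtain P p q where pb: "is_pullback \<E> P p q s t" using pullback_exists[OF s t] by blast
  have p: "p \<in> Hom \<E> P L\<^sub>1" and q: "q \<in> Hom \<E> P L\<^sub>1" and pq: "s \<cdot> p = t \<cdot> q"
    using pb s t unfolding is_pullback_def by (auto simp: Hom_def)
  have comp: "composable \<E> (D\<^sub>0 i) V (l\<^sub>1 i \<cdot> g) (l\<^sub>1 i \<cdot> f)"
    if i: "i \<in> Ob J" and g: "g \<in> Hom \<E> V L\<^sub>1" and f: "f \<in> Hom \<E> V L\<^sub>1" and gf: "s \<cdot> g = t \<cdot> f"
    for i V g f
    using s_Cmp[OF i g] t_Cmp[OF i f] gf Cmp_in_Hom[OF g l\<^sub>1[OF i]] Cmp_in_Hom[OF f l\<^sub>1[OF i]]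
    by (simp add: composable_def)
  note comp_pq = comp[OF _ p q pq]
  note icomp_pq = internal_magmoid.icomp_in_Hom[OF mag comp_pq]
  \<comment> \<open>The composites of the projected generic pair form a cone because the functors
    \<open>D\<^sub>1 a\<close> preserve composition; \<open>c\<close> becomes the
    multiplication.\<close>
  obtain c where c: "c \<in> Hom \<E> P L\<^sub>1"
    and c_eq: "\<And>i. i \<in> Ob J \<Longrightarrow> l\<^sub>1 i \<cdot> c = icomp \<E> (D\<^sub>0 i) (l\<^sub>1 i \<cdot> p) (l\<^sub>1 i \<cdot> q)"
  proof (rule limit_factor[OF lim1, of P "\<lambda>i. icomp \<E> (D\<^sub>0 i) (l\<^sub>1 i \<cdot> p) (l\<^sub>1 i \<cdot> q)"])
    show "P \<in> Ob \<E>" using Hom_Ob[OF p] by blast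
    show "icomp \<E> (D\<^sub>0 i) (l\<^sub>1 i \<cdot> p) (l\<^sub>1 i \<cdot> q) \<in> Hom \<E> P (X1 (D\<^sub>0 i))" if "i \<in> Ob J" for i
      using icomp_pq that by blast
    fix a assume a: "a \<in> Mor J"
    let ?i = "Dom J a" and ?j = "Cod J a"
    note i = J.Dom_in_Ob[OF a] and F = functor_betweenD[OF D\<^sub>1[OF a]]
    have "F1 (D\<^sub>1 a) \<cdot> (l\<^sub>1 ?i \<cdot> x) = l\<^sub>1 ?j \<cdot> x" if "x \<in> Hom \<E> P L\<^sub>1" for x
      using Cmp_eq_single[OF limit_cone(3)[OF lim1 a] that l\<^sub>1[OF i] F(4)] .
    then show "F1 (D\<^sub>1 a) \<cdot> icomp \<E> (D\<^sub>0 ?i) (l\<^sub>1 ?i \<cdot> p) (l\<^sub>1 ?i \<cdot> q) =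
        icomp \<E> (D\<^sub>0 ?j) (l\<^sub>1 ?j \<cdot> p) (l\<^sub>1 ?j \<cdot> q)"
      using F(9)[OF comp_pq[OF i]] p q by simp
  qed blast
  define L where "L = \<lparr>X0 = L\<^sub>0, X1 = L\<^sub>1, X2 = P, src = s, tgt = t, unt = e, prl = p, prr = q, mult = c\<rparr>"
  have [simp]: "X0 L = L\<^sub>0" "X1 L = L\<^sub>1" "X2 L = P" "src L = s" "tgt L = t" "unt L = e"
    "prl L = p" "prr L = q" "mult L = c" by (simp_all add: L_def)
  interpret L: internal_magmoid \<E> L
  proof
    show "src L \<in> Hom \<E> (X1 L) (X0 L)" "tgt L \<in> Hom \<E> (X1 L) (X0 L)" "unt L \<in> Hom \<E> (X0 L) (X1 L)"
      "mult L \<in> Hom \<E> (X2 L) (X1 L)" using s t e c by simp_all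
    show "is_pullback \<E> (X2 L) (prl L) (prr L) (src L) (tgt L)" using pb by simp
    have L0: "Idn \<E> L\<^sub>0 \<in> Hom \<E> L\<^sub>0 L\<^sub>0" using Idn_in_Hom limit_cone(1)[OF lim0] by blast
    have "s \<cdot> e = Idn \<E> L\<^sub>0"
    proof (rule mono0[OF Cmp_in_Hom[OF e s] L0])
      fix i assume i: "i \<in> Ob J"
      show "l\<^sub>0 i \<cdot> (s \<cdot> e) = l\<^sub>0 i \<cdot> Idn \<E> L\<^sub>0"
        using s_Cmp[OF i e] e_eq[OF i] internal_magmoid.src_unt_Cmp[OF mag[OF i] l\<^sub>0[OF i]]
          Cmp_Idn_right[OF l\<^sub>0[OF i]] by simp
    qed
    then show "src L \<cdot> unt L = Idn \<E> (X0 L)" by simp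
    have "t \<cdot> e = Idn \<E> L\<^sub>0"
    proof (rule mono0[OF Cmp_in_Hom[OF e t] L0])
      fix i assume i: "i \<in> Ob J"
      show "l\<^sub>0 i \<cdot> (t \<cdot> e) = l\<^sub>0 i \<cdot> Idn \<E> L\<^sub>0"
        using t_Cmp[OF i e] e_eq[OF i] internal_magmoid.tgt_unt_Cmp[OF mag[OF i] l\<^sub>0[OF i]]
          Cmp_Idn_right[OF l\<^sub>0[OF i]] by simp
    qed
    then show "tgt L \<cdot> unt L = Idn \<E> (X0 L)" by simp
    have "s \<cdot> c = s \<cdot> q"
    proof (rule mono0[OF Cmp_in_Hom[OF c s] Cmp_in_Hom[OF q s]])
      fix i assume i: "i \<in> Ob J"
      show "l\<^sub>0 i \<cdot> (s \<cdot> c) = l\<^sub>0 i \<cdot> (s \<cdot> q)"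
        using s_Cmp[OF i c] s_Cmp[OF i q] c_eq[OF i]
          internal_magmoid.src_icomp[OF mag[OF i] comp_pq[OF i]] by simp
    qed
    then show "src L \<cdot> mult L = src L \<cdot> prr L" by simp
    have "t \<cdot> c = t \<cdot> p"
    proof (rule mono0[OF Cmp_in_Hom[OF c t] Cmp_in_Hom[OF p t]])
      fix i assume i: "i \<in> Ob J"
      show "l\<^sub>0 i \<cdot> (t \<cdot> c) = l\<^sub>0 i \<cdot> (t \<cdot> p)"
        using t_Cmp[OF i c] t_Cmp[OF i p] c_eq[OF i]
          internal_magmoid.tgt_icomp[OF mag[OF i] comp_pq[OF i]] by simp
    qed
    then show "tgt L \<cdot> mult L = tgt L \<cdot> prl L" by simp
  qed
  have comp_L: "composable \<E> (D\<^sub>0 i) V (l\<^sub>1 i \<cdot> g) (l\<^sub>1 i \<cdot> f)"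
    if "i \<in> Ob J" "composable \<E> L V g f" for i V g f
    using comp[OF that(1), of g V f] that(2) by (simp add: composable_def)
  \<comment> \<open>The equation defining \<open>c\<close> extends from the generic pair to all
    pairs. It reduces the unit and associativity laws to those of \<open>D\<^sub>0 i\<close>, and
    also makes the projections functors.\<close>
  have icomp_L: "l\<^sub>1 i \<cdot> icomp \<E> L g f = icomp \<E> (D\<^sub>0 i) (l\<^sub>1 i \<cdot> g) (l\<^sub>1 i \<cdot> f)"
    if i: "i \<in> Ob J" and gf: "composable \<E> L V g f" for i V g f
  proof -
    have k: "ipair \<E> L g f \<in> Hom \<E> V P" using L.ipair_in_Hom[OF gf] by simp
    have "l\<^sub>1 i \<cdot> (c \<cdot> ipair \<E> L g f) = icomp \<E> (D\<^sub>0 i) (l\<^sub>1 i \<cdot> p) (l\<^sub>1 i \<cdot> q) \<cdot> ipair \<E> L g f"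
      using Cmp_eq_single[OF c_eq[OF i] k c l\<^sub>1[OF i]] .
    then show ?thesis
      using internal_magmoid.icomp_Cmp[OF mag[OF i] comp_pq[OF i] k]
        Cmp_assoc[OF k p l\<^sub>1[OF i]] Cmp_assoc[OF k q l\<^sub>1[OF i]]
        L.prl_ipair[OF gf] L.prr_ipair[OF gf] by (simp add: icomp_def)
  qed
  have mono1': "h = k" if "h \<in> Hom \<E> V (X1 L)" "k \<in> Hom \<E> V (X1 L)"
    "\<And>i. i \<in> Ob J \<Longrightarrow> l\<^sub>1 i \<cdot> h = l\<^sub>1 i \<cdot> k" for h k V using mono1[of h V k] that by simp
  have L: "internal_category \<E> L"
  proof (rule L.internal_categoryI)
    fix U g assume g: "g \<in> Hom \<E> U (X1 L)"
    then have g': "g \<in> Hom \<E> U L\<^sub>1" by simp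
    show "icomp \<E> L g (unt L \<cdot> (src L \<cdot> g)) = g"
    proof (rule mono1'[OF L.icomp_in_Hom[OF L.composable_unt_right[OF g]] g])
      fix i assume i: "i \<in> Ob J"
      show "l\<^sub>1 i \<cdot> icomp \<E> L g (unt L \<cdot> (src L \<cdot> g)) = l\<^sub>1 i \<cdot> g"
        using icomp_L[OF i L.composable_unt_right[OF g]] e_Cmp[OF i Cmp_in_Hom[OF g' s]]
          s_Cmp[OF i g'] Cmp_in_Hom[OF g' l\<^sub>1[OF i]]
          internal_category_in.icomp_unt_right[OF D[OF i]] by simp
    qed
    show "icomp \<E> L (unt L \<cdot> (tgt L \<cdot> g)) g = g"
    proof (rule mono1'[OF L.icomp_in_Hom[OF L.composable_unt_left[OF g]] g])
      fix i assume i: "i \<in> Ob J"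
      show "l\<^sub>1 i \<cdot> icomp \<E> L (unt L \<cdot> (tgt L \<cdot> g)) g = l\<^sub>1 i \<cdot> g"
        using icomp_L[OF i L.composable_unt_left[OF g]] e_Cmp[OF i Cmp_in_Hom[OF g' t]]
          t_Cmp[OF i g'] Cmp_in_Hom[OF g' l\<^sub>1[OF i]]
          internal_category_in.icomp_unt_left[OF D[OF i]] by simp
    qed
  next
    fix U h g f assume hg: "composable \<E> L U h g" and gf: "composable \<E> L U g f"
    note hgf = L.composable_icomp[OF hg gf]
    show "icomp \<E> L (icomp \<E> L h g) f = icomp \<E> L h (icomp \<E> L g f)"
    proof (rule mono1'[OF L.icomp_in_Hom[OF hgf(1)] L.icomp_in_Hom[OF hgf(2)]])
      fix i assume i: "i \<in> Ob J"
      show "l\<^sub>1 i \<cdot> icomp \<E> L (icomp \<E> L h g) f = l\<^sub>1 i \<cdot> icomp \<E> L h (icomp \<E> L g f)"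
        using icomp_L[OF i hgf(1)] icomp_L[OF i hgf(2)] icomp_L[OF i hg] icomp_L[OF i gf]
          internal_category_in.icomp_assoc[OF D[OF i] comp_L[OF i hg] comp_L[OF i gf]] by simp
    qed
  qed
  define l where "l = (\<lambda>i. \<lparr>fdom = L, fcod = D\<^sub>0 i, F0 = l\<^sub>0 i, F1 = l\<^sub>1 i\<rparr>)"
  have "functor_between \<E> L (D\<^sub>0 i) (l i)" if i: "i \<in> Ob J" for i
    unfolding l_def
  proof (rule functor_betweenI[OF L D\<^sub>0[OF i]])
    show "l\<^sub>0 i \<in> Hom \<E> (X0 L) (X0 (D\<^sub>0 i))" "l\<^sub>1 i \<in> Hom \<E> (X1 L) (X1 (D\<^sub>0 i))"
      using l\<^sub>0[OF i] l\<^sub>1[OF i] by simp_all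
    show "src (D\<^sub>0 i) \<cdot> l\<^sub>1 i = l\<^sub>0 i \<cdot> src L" "tgt (D\<^sub>0 i) \<cdot> l\<^sub>1 i = l\<^sub>0 i \<cdot> tgt L"
      "l\<^sub>1 i \<cdot> unt L = unt (D\<^sub>0 i) \<cdot> l\<^sub>0 i" using s_eq[OF i] t_eq[OF i] e_eq[OF i] by simp_all
  qed (use comp_L[OF i] icomp_L[OF i] in blast)
  then have "levelwise_limit L l"
    unfolding levelwise_limit_def using L lim0 lim1 by (simp add: l_def)
  then show ?thesis by blast
qed

end

section \<open>Internal groupoids\<close>

definition is_inverse :: "('o, 'm) cat \<Rightarrow> ('o, 'm) icat \<Rightarrow> 'm \<Rightarrow> bool" where
  "is_inverse \<E> X i \<longleftrightarrow>
     i \<in> Hom \<E> (X1 X) (X1 X) \<and> src X \<cdot>\<^bsub>\<E>\<^esub> i = tgt X \<and> tgt X \<cdot>\<^bsub>\<E>\<^esub> i = src X \<and>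
     icomp \<E> X i (Idn \<E> (X1 X)) = unt X \<cdot>\<^bsub>\<E>\<^esub> src X \<and>
     icomp \<E> X (Idn \<E> (X1 X)) i = unt X \<cdot>\<^bsub>\<E>\<^esub> tgt X"

lemma internal_groupoid_iff:
  "internal_groupoid \<E> X \<longleftrightarrow> internal_category \<E> X \<and> (\<exists>i. is_inverse \<E> X i)"
  unfolding internal_groupoid_def is_inverse_def icomp_def by blast

context internal_magmoid
begin

lemma is_inverse_composable:
  assumes "is_inverse \<E> X i"
  shows "composable \<E> X (X1 X) i (Idn \<E> (X1 X))" "composable \<E> X (X1 X) (Idn \<E> (X1 X)) i"
  using assms Idn_in_Hom Hom_Ob[OF src_in_Hom] Cmp_Idn_right[OF src_in_Hom]
    Cmp_Idn_right[OF tgt_in_Hom] by (simp_all add: is_inverse_def composable_def)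

lemma is_inverse_Cmp:
  assumes i: "is_inverse \<E> X i" and f: "f \<in> Hom \<E> U (X1 X)"
  shows "composable \<E> X U (i \<cdot> f) f" "composable \<E> X U f (i \<cdot> f)"
    and "icomp \<E> X (i \<cdot> f) f = unt X \<cdot> (src X \<cdot> f)" "icomp \<E> X f (i \<cdot> f) = unt X \<cdot> (tgt X \<cdot> f)"
proof -
  note c = is_inverse_composable[OF i]
  have i': "icomp \<E> X i (Idn \<E> (X1 X)) = unt X \<cdot> src X" "icomp \<E> X (Idn \<E> (X1 X)) i = unt X \<cdot> tgt X"
    using i by (simp_all add: is_inverse_def)
  show "composable \<E> X U (i \<cdot> f) f" "composable \<E> X U f (i \<cdot> f)"
    using composable_Cmp[OF c(1) f] composable_Cmp[OF c(2) f] Cmp_Idn_left[OF f] by simp_all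
  show "icomp \<E> X (i \<cdot> f) f = unt X \<cdot> (src X \<cdot> f)"
    using icomp_Cmp[OF c(1) f] i'(1) Cmp_assoc[OF f src_in_Hom unt_in_Hom] Cmp_Idn_left[OF f] by simp
  show "icomp \<E> X f (i \<cdot> f) = unt X \<cdot> (tgt X \<cdot> f)"
    using icomp_Cmp[OF c(2) f] i'(2) Cmp_assoc[OF f tgt_in_Hom unt_in_Hom] Cmp_Idn_left[OF f] by simp
qed

end

text \<open>Applying the functor to the law for \<open>i\<close> shows that
  \<open>F1 F \<cdot> i\<close> is a left inverse of \<open>F1 F\<close>, viewed as a generalized
  arrow of \<open>Y\<close>; \<open>j \<cdot> F1 F\<close> is a right inverse of it, and the two
  agree.\<close>

lemma (in lex_category) functor_inverse:
  assumes F: "functor_between \<E> X Y F" and i: "is_inverse \<E> X i" and j: "is_inverse \<E> Y j"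
  shows "F1 F \<cdot> i = j \<cdot> F1 F"
proof -
  note D = functor_betweenD[OF F]
  interpret X: internal_category_in \<E> X using internal_category_in[OF D(1)] .
  interpret Y: internal_category_in \<E> Y using internal_category_in[OF D(2)] .
  note c = X.is_inverse_composable(1)[OF i] and Id = Cmp_Idn_right[OF D(4)]
  have "icomp \<E> X i (Idn \<E> (X1 X)) = unt X \<cdot> src X" using i by (simp add: is_inverse_def)
  then have "icomp \<E> Y (F1 F \<cdot> i) (F1 F) = unt Y \<cdot> (src Y \<cdot> F1 F)"
    using D(9)[OF c] Id functor_unt[OF F X.src_in_Hom] D(5) by simp
  moreover have "composable \<E> Y (X1 X) (F1 F \<cdot> i) (F1 F)" using D(8)[OF c] Id by simp
  ultimately show ?thesis
    using Y.inverse_unique[OF _ Y.is_inverse_Cmp(2)[OF j D(4)]] Y.is_inverse_Cmp(4)[OF j D(4)] by blast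
qed

text \<open>The inversions of the vertices, composed with the projections, form a cone because
  functors commute with inversion. The induced \<open>w\<close> satisfies the inverse laws, as is
  checked on the projections.\<close>

lemma (in internal_diagram) levelwise_limit_groupoid:
  assumes lim: "levelwise_limit L l" and grd: "\<And>i. i \<in> Ob J \<Longrightarrow> internal_groupoid \<E> (D\<^sub>0 i)"
  shows "internal_groupoid \<E> L"
proof -
  have L: "internal_category \<E> L" and l: "\<And>i. i \<in> Ob J \<Longrightarrow> functor_between \<E> L (D\<^sub>0 i) (l i)"
    and lim1: "is_limit J \<E> (\<lambda>i. X1 (D\<^sub>0 i)) (\<lambda>a. F1 (D\<^sub>1 a)) (X1 L) (\<lambda>i. F1 (l i))"
    using lim by (auto simp: levelwise_limit_def)
  note mono0 = jointly_monicD[OF levelwise_limit_jointly_monic(1)[OF lim]]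
  note mono1 = jointly_monicD[OF levelwise_limit_jointly_monic(2)[OF lim]]
  interpret L: internal_category_in \<E> L using internal_category_in[OF L] .
  note lD = functor_betweenD[OF l]
  have mag: "internal_magmoid \<E> (D\<^sub>0 i)" if "i \<in> Ob J" for i
    using internal_category_in[OF D\<^sub>0[OF that]] by (simp add: internal_category_in_def)
  \<comment> \<open>An independent choice at each vertex; compatibility along
    \<open>D\<^sub>1 a\<close> is automatic by \<open>functor_inverse\<close>.\<close>
  define v where "v = (\<lambda>i. SOME v. is_inverse \<E> (D\<^sub>0 i) v)"
  have v: "is_inverse \<E> (D\<^sub>0 i) (v i)" if "i \<in> Ob J" for i
    using grd[OF that] someI_ex[of "is_inverse \<E> (D\<^sub>0 i)"] by (simp add: internal_groupoid_iff v_def)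
  note v_in_Hom = v[unfolded is_inverse_def, THEN conjunct1]
  obtain w where w: "w \<in> Hom \<E> (X1 L) (X1 L)"
    and w_eq: "\<And>i. i \<in> Ob J \<Longrightarrow> F1 (l i) \<cdot> w = v i \<cdot> F1 (l i)"
  proof (rule limit_factor[OF lim1 limit_cone(1)[OF lim1], of "\<lambda>i. v i \<cdot> F1 (l i)"])
    show "v i \<cdot> F1 (l i) \<in> Hom \<E> (X1 L) (X1 (D\<^sub>0 i))" if "i \<in> Ob J" for i
      using Cmp_in_Hom[OF lD(4)[OF that] v_in_Hom[OF that]] .
    show "F1 (D\<^sub>1 a) \<cdot> (v (Dom J a) \<cdot> F1 (l (Dom J a))) = v (Cod J a) \<cdot> F1 (l (Cod J a))"
      if a: "a \<in> Mor J" for a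
    proof -
      note i = J.Dom_in_Ob[OF a] and j = J.Cod_in_Ob[OF a]
      note F = functor_betweenD(4)[OF D\<^sub>1[OF a]]
      show ?thesis
        using Cmp_eq_Cmp[OF functor_inverse[OF D\<^sub>1[OF a] v[OF i] v[OF j]] lD(4)[OF i]
            v_in_Hom[OF i] F F v_in_Hom[OF j]] limit_cone(3)[OF lim1 a] by simp
    qed
  qed blast
  let ?I = "Idn \<E> (X1 L)"
  have I: "?I \<in> Hom \<E> (X1 L) (X1 L)" using Idn_in_Hom L.X1_in_Ob by blast
  have v_st: "src (D\<^sub>0 i) \<cdot> (v i \<cdot> F1 (l i)) = tgt (D\<^sub>0 i) \<cdot> F1 (l i)"
    "tgt (D\<^sub>0 i) \<cdot> (v i \<cdot> F1 (l i)) = src (D\<^sub>0 i) \<cdot> F1 (l i)" if i: "i \<in> Ob J" for i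
    using Cmp_eq_single[OF _ lD(4)[OF i] v_in_Hom[OF i] internal_magmoid.src_in_Hom[OF mag[OF i]]]
      Cmp_eq_single[OF _ lD(4)[OF i] v_in_Hom[OF i] internal_magmoid.tgt_in_Hom[OF mag[OF i]]]
      v[OF i] by (simp_all add: is_inverse_def)
  have src: "src L \<cdot> w = tgt L"
  proof (rule mono0[OF Cmp_in_Hom[OF w L.src_in_Hom] L.tgt_in_Hom])
    fix i assume i: "i \<in> Ob J"
    show "F0 (l i) \<cdot> (src L \<cdot> w) = F0 (l i) \<cdot> tgt L"
      using functor_src(1)[OF l[OF i] w] w_eq[OF i] v_st(1)[OF i] lD(6)[OF i] by simp
  qed
  have tgt: "tgt L \<cdot> w = src L"
  proof (rule mono0[OF Cmp_in_Hom[OF w L.tgt_in_Hom] L.src_in_Hom])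
    fix i assume i: "i \<in> Ob J"
    show "F0 (l i) \<cdot> (tgt L \<cdot> w) = F0 (l i) \<cdot> src L"
      using functor_src(2)[OF l[OF i] w] w_eq[OF i] v_st(2)[OF i] lD(5)[OF i] by simp
  qed
  have c: "composable \<E> L (X1 L) w ?I" "composable \<E> L (X1 L) ?I w"
    using w I src tgt Cmp_Idn_right[OF L.src_in_Hom] Cmp_Idn_right[OF L.tgt_in_Hom]
    by (simp_all add: composable_def)
  have left: "icomp \<E> L w ?I = unt L \<cdot> src L"
  proof (rule mono1[OF L.icomp_in_Hom[OF c(1)] Cmp_in_Hom[OF L.src_in_Hom L.unt_in_Hom]])
    fix i assume i: "i \<in> Ob J"
    show "F1 (l i) \<cdot> icomp \<E> L w ?I = F1 (l i) \<cdot> (unt L \<cdot> src L)"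
      using lD(9)[OF i c(1)] w_eq[OF i] Cmp_Idn_right[OF lD(4)[OF i]]
        internal_magmoid.is_inverse_Cmp(3)[OF mag[OF i] v[OF i] lD(4)[OF i]]
        functor_unt[OF l[OF i] L.src_in_Hom] lD(5)[OF i] by simp
  qed
  have right: "icomp \<E> L ?I w = unt L \<cdot> tgt L"
  proof (rule mono1[OF L.icomp_in_Hom[OF c(2)] Cmp_in_Hom[OF L.tgt_in_Hom L.unt_in_Hom]])
    fix i assume i: "i \<in> Ob J"
    show "F1 (l i) \<cdot> icomp \<E> L ?I w = F1 (l i) \<cdot> (unt L \<cdot> tgt L)"
      using lD(9)[OF i c(2)] w_eq[OF i] Cmp_Idn_right[OF lD(4)[OF i]]
        internal_magmoid.is_inverse_Cmp(4)[OF mag[OF i] v[OF i] lD(4)[OF i]]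
        functor_unt[OF l[OF i] L.tgt_in_Hom] lD(6)[OF i] by simp
  qed
  have "is_inverse \<E> L w" using w src tgt left right by (simp add: is_inverse_def)
  then show ?thesis using L internal_groupoid_iff by blast
qed

section \<open>Full subcategories of the category of internal categories\<close>

text \<open>The predicate is \<open>internal_category \<E>\<close> for \<open>Cat \<E>\<close> and
  \<open>internal_groupoid \<E>\<close> for \<open>Grd \<E>\<close>, so everything below is proved
  once for both.\<close>

definition full_Cat ::
  "('o, 'm) cat \<Rightarrow> (('o, 'm) icat \<Rightarrow> bool) \<Rightarrow> (('o, 'm) icat, ('o, 'm) ifun) cat" where
  "full_Cat \<E> P = (Cat \<E>)
     \<lparr>Ob := {X. P X}, Mor := {F. internal_functor \<E> F \<and> P (fdom F) \<and> P (fcod F)}\<rparr>"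

lemma Grd_eq_full_Cat: "Grd \<E> = full_Cat \<E> (internal_groupoid \<E>)"
  by (simp add: Grd_def full_Cat_def)

lemma Cat_eq_full_Cat: "Cat \<E> = full_Cat \<E> (internal_category \<E>)"
proof -
  have "{F. internal_functor \<E> F} =
      {F. internal_functor \<E> F \<and> internal_category \<E> (fdom F) \<and> internal_category \<E> (fcod F)}"
    by (auto simp: internal_functor_def Let_def)
  then show ?thesis by (simp add: full_Cat_def Cat_def)
qed

lemma Hom_full_Cat:
  "F \<in> Hom (full_Cat \<E> P) X Y \<longleftrightarrow> functor_between \<E> X Y F \<and> P X \<and> P Y"
  by (auto simp: full_Cat_def Cat_def Hom_def functor_between_def)

lemma full_Cat_simps [simp]:
  "Ob (full_Cat \<E> P) = {X. P X}" "Dom (full_Cat \<E> P) = fdom" "Cod (full_Cat \<E> P) = fcod"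
  "Idn (full_Cat \<E> P) X = \<lparr>fdom = X, fcod = X, F0 = Idn \<E> (X0 X), F1 = Idn \<E> (X1 X)\<rparr>"
  "G \<cdot>\<^bsub>full_Cat \<E> P\<^esub> F =
    \<lparr>fdom = fdom F, fcod = fcod G, F0 = F0 G \<cdot>\<^bsub>\<E>\<^esub> F0 F, F1 = F1 G \<cdot>\<^bsub>\<E>\<^esub> F1 F\<rparr>"
  by (simp_all add: full_Cat_def Cat_def)

text \<open>The record of an internal functor contains its ends, so its two levels determine it only
  after these are fixed.\<close>

lemma functor_between_eqI:
  "functor_between \<E> X Y F \<Longrightarrow> functor_between \<E> X Y G \<Longrightarrow> F0 F = F0 G \<Longrightarrow> F1 F = F1 G \<Longrightarrow> F = G"
  unfolding functor_between_def by (cases F; cases G) auto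

text \<open>Closure under levelwise limits is all that distinguishes the two cases. The shapes have
  type \<open>(nat, nat) cat\<close> to match \<open>finitely_complete\<close>.\<close>

locale internal_full_subcategory = lex_category \<E> for \<E> :: "('o, 'm) cat" (structure) +
  fixes P :: "('o, 'm) icat \<Rightarrow> bool"
  assumes P_internal_category: "P X \<Longrightarrow> internal_category \<E> X"
    and P_levelwise_limit: "internal_diagram \<E> J D\<^sub>0 D\<^sub>1 \<Longrightarrow>
      internal_diagram.levelwise_limit \<E> J D\<^sub>0 D\<^sub>1 L l \<Longrightarrow>
      (\<And>i. i \<in> Ob (J :: (nat, nat) cat) \<Longrightarrow> P (D\<^sub>0 i)) \<Longrightarrow> P L"
begin

lemma category_full_Cat: "category (full_Cat \<E> P)"
proof
  show "Dom (full_Cat \<E> P) F \<in> Ob (full_Cat \<E> P)" "Cod (full_Cat \<E> P) F \<in> Ob (full_Cat \<E> P)"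
    if "F \<in> Mor (full_Cat \<E> P)" for F
    using that by (simp_all add: full_Cat_def Cat_def)
  show "Idn (full_Cat \<E> P) X \<in> Hom (full_Cat \<E> P) X X" if "X \<in> Ob (full_Cat \<E> P)" for X
    using that functor_Idn P_internal_category by (simp add: Hom_full_Cat)
  show "G \<cdot>\<^bsub>full_Cat \<E> P\<^esub> F \<in> Hom (full_Cat \<E> P) X Z"
    if F: "F \<in> Hom (full_Cat \<E> P) X Y" and G: "G \<in> Hom (full_Cat \<E> P) Y Z" for F G X Y Z
  proof -
    have "fdom F = X" "fcod G = Z" using F G by (simp_all add: Hom_full_Cat functor_between_def)
    then show ?thesis using F G functor_Cmp[of X Y F Z G] by (simp add: Hom_full_Cat)
  qed
  show "Idn (full_Cat \<E> P) Y \<cdot>\<^bsub>full_Cat \<E> P\<^esub> F = F" if F: "F \<in> Hom (full_Cat \<E> P) X Y" for F X Y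
  proof -
    have "functor_between \<E> X Y F" using F by (simp add: Hom_full_Cat)
    from functor_betweenD(3,4)[OF this] this show ?thesis
      using Cmp_Idn_left by (cases F) (auto simp: functor_between_def)
  qed
  show "F \<cdot>\<^bsub>full_Cat \<E> P\<^esub> Idn (full_Cat \<E> P) X = F" if F: "F \<in> Hom (full_Cat \<E> P) X Y" for F X Y
  proof -
    have "functor_between \<E> X Y F" using F by (simp add: Hom_full_Cat)
    from functor_betweenD(3,4)[OF this] this show ?thesis
      using Cmp_Idn_right by (cases F) (auto simp: functor_between_def)
  qed
  show "H \<cdot>\<^bsub>full_Cat \<E> P\<^esub> G \<cdot>\<^bsub>full_Cat \<E> P\<^esub> F = H \<cdot>\<^bsub>full_Cat \<E> P\<^esub> (G \<cdot>\<^bsub>full_Cat \<E> P\<^esub> F)"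
    if F: "F \<in> Hom (full_Cat \<E> P) X Y" and G: "G \<in> Hom (full_Cat \<E> P) Y Z"
      and H: "H \<in> Hom (full_Cat \<E> P) Z W" for F G H X Y Z W
  proof -
    have F: "functor_between \<E> X Y F" and G: "functor_between \<E> Y Z G"
      and H: "functor_between \<E> Z W H" using F G H by (simp_all add: Hom_full_Cat)
    show ?thesis
      using Cmp_assoc[OF functor_betweenD(3)[OF F] functor_betweenD(3)[OF G] functor_betweenD(3)[OF H]]
        Cmp_assoc[OF functor_betweenD(4)[OF F] functor_betweenD(4)[OF G] functor_betweenD(4)[OF H]]
      by simp
  qed
qed

section \<open>Limits and level functors of a full subcategory\<close>

sublocale full: category "full_Cat \<E> P"
  by (fact category_full_Cat)

lemma cat_functor_level0: "cat_functor (full_Cat \<E> P) \<E> X0 F0"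
  and cat_functor_level1: "cat_functor (full_Cat \<E> P) \<E> X1 F1"
proof -
  have M: "functor_between \<E> (fdom F) (fcod F) F" if "F \<in> Mor (full_Cat \<E> P)" for F
    using that by (simp add: full_Cat_def functor_between_def)
  have O: "internal_category \<E> X" if "P X" for X using P_internal_category[OF that] .
  show "cat_functor (full_Cat \<E> P) \<E> X0 F0" "cat_functor (full_Cat \<E> P) \<E> X1 F1"
    unfolding cat_functor_def
    using O[THEN internal_category.X0_in_Ob] O[THEN internal_category.X1_in_Ob]
      functor_betweenD(3,4)[OF M] by simp_all
qed

lemma internal_diagram_full_Cat:
  assumes "category J" and D: "cat_functor J (full_Cat \<E> P) D\<^sub>0 D\<^sub>1"
  shows "internal_diagram \<E> J D\<^sub>0 D\<^sub>1"
proof -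
  interpret J: category J by fact
  have D0: "P (D\<^sub>0 i)" if "i \<in> Ob J" for i
    using D that by (simp add: cat_functor_def)
  have D1: "functor_between \<E> (D\<^sub>0 (Dom J a)) (D\<^sub>0 (Cod J a)) (D\<^sub>1 a)" if "a \<in> Mor J" for a
    using D that by (simp add: cat_functor_def Hom_full_Cat)
  note DI = D0[THEN P_internal_category]
  have Idn: "D\<^sub>1 (Idn J i) = Idn (full_Cat \<E> P) (D\<^sub>0 i)" if "i \<in> Ob J" for i
    using D that by (simp add: cat_functor_def del: full_Cat_simps)
  have Cmp: "D\<^sub>1 (b \<cdot>\<^bsub>J\<^esub> a) = D\<^sub>1 b \<cdot>\<^bsub>full_Cat \<E> P\<^esub> D\<^sub>1 a"
    if "a \<in> Mor J" "b \<in> Mor J" "Cod J a = Dom J b" for a b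
    using D that by (simp add: cat_functor_def del: full_Cat_simps)
  show ?thesis
  proof (intro internal_diagram.intro internal_diagram_axioms.intro)
    show "lex_category \<E>" "category J" by unfold_locales
    show "internal_category \<E> (D\<^sub>0 i)" if "i \<in> Ob J" for i using DI[OF that] .
    show "functor_between \<E> (D\<^sub>0 (Dom J a)) (D\<^sub>0 (Cod J a)) (D\<^sub>1 a)" if "a \<in> Mor J" for a
      using D1[OF that] .
    show "cat_functor J \<E> (\<lambda>i. X0 (D\<^sub>0 i)) (\<lambda>a. F0 (D\<^sub>1 a))"
      "cat_functor J \<E> (\<lambda>i. X1 (D\<^sub>0 i)) (\<lambda>a. F1 (D\<^sub>1 a))"
      unfolding cat_functor_def
      using DI[THEN internal_category.X0_in_Ob] DI[THEN internal_category.X1_in_Ob]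
        functor_betweenD(3,4)[OF D1] Idn Cmp by simp_all
  qed
qed

text \<open>The mediating functor is assembled from the mediating morphisms of the two levels.
  Fullness makes it a morphism of the subcategory as soon as \<open>P L\<close> holds, and joint
  monicity at each level makes it unique.\<close>

lemma levelwise_limit_is_limit:
  assumes J: "category J" and D: "cat_functor J (full_Cat \<E> P) D\<^sub>0 D\<^sub>1"
    and lim: "internal_diagram.levelwise_limit \<E> J D\<^sub>0 D\<^sub>1 L l" and "P L"
  shows "is_limit J (full_Cat \<E> P) D\<^sub>0 D\<^sub>1 L l"
proof -
  interpret internal_diagram \<E> J D\<^sub>0 D\<^sub>1 using internal_diagram_full_Cat[OF J D] .
  have D0: "P (D\<^sub>0 i)" if "i \<in> Ob J" for i using D that by (simp add: cat_functor_def)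
  have l: "\<And>i. i \<in> Ob J \<Longrightarrow> functor_between \<E> L (D\<^sub>0 i) (l i)" and L: "internal_category \<E> L"
    and lim0: "is_limit J \<E> (\<lambda>i. X0 (D\<^sub>0 i)) (\<lambda>a. F0 (D\<^sub>1 a)) (X0 L) (\<lambda>i. F0 (l i))"
    and lim1: "is_limit J \<E> (\<lambda>i. X1 (D\<^sub>0 i)) (\<lambda>a. F1 (D\<^sub>1 a)) (X1 L) (\<lambda>i. F1 (l i))"
    using lim by (auto simp: levelwise_limit_def)
  note mono = levelwise_limit_jointly_monic[OF lim]
  have "is_cone J (full_Cat \<E> P) D\<^sub>0 D\<^sub>1 L l"
    unfolding is_cone_def
  proof (intro conjI ballI)
    show "L \<in> Ob (full_Cat \<E> P)" using \<open>P L\<close> by simp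
    show l': "l i \<in> Hom (full_Cat \<E> P) L (D\<^sub>0 i)" if "i \<in> Ob J" for i
      using l[OF that] D0[OF that] \<open>P L\<close> by (simp add: Hom_full_Cat)
    fix a assume a: "a \<in> Mor J"
    show "D\<^sub>1 a \<cdot>\<^bsub>full_Cat \<E> P\<^esub> l (Dom J a) = l (Cod J a)"
      using l[OF J.Dom_in_Ob[OF a]] l[OF J.Cod_in_Ob[OF a]] D\<^sub>1[OF a]
        limit_cone(3)[OF lim0 a] limit_cone(3)[OF lim1 a]
      by (cases "l (Cod J a)") (simp add: functor_between_def)
  qed
  moreover have "\<exists>!h. h \<in> Hom (full_Cat \<E> P) U L \<and> (\<forall>i\<in>Ob J. l i \<cdot>\<^bsub>full_Cat \<E> P\<^esub> h = u i)"
    if cone: "is_cone J (full_Cat \<E> P) D\<^sub>0 D\<^sub>1 U u" for U u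
  proof -
    have "P U" using cone by (simp add: is_cone_def)
    have U: "internal_category \<E> U" using P_internal_category[OF \<open>P U\<close>] .
    have u: "functor_between \<E> U (D\<^sub>0 i) (u i)" if "i \<in> Ob J" for i
      using cone that by (simp add: is_cone_def Hom_full_Cat)
    have u_eq: "D\<^sub>1 a \<cdot>\<^bsub>full_Cat \<E> P\<^esub> u (Dom J a) = u (Cod J a)" if "a \<in> Mor J" for a
      using cone that by (simp add: is_cone_def del: full_Cat_simps)
    have u_eq0: "F0 (D\<^sub>1 a) \<cdot> F0 (u (Dom J a)) = F0 (u (Cod J a))"
      and u_eq1: "F1 (D\<^sub>1 a) \<cdot> F1 (u (Dom J a)) = F1 (u (Cod J a))" if "a \<in> Mor J" for a
      using u_eq[OF that, symmetric] by simp_all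
    obtain h\<^sub>0 where h\<^sub>0: "h\<^sub>0 \<in> Hom \<E> (X0 U) (X0 L)"
      and h\<^sub>0_eq: "\<And>i. i \<in> Ob J \<Longrightarrow> F0 (l i) \<cdot> h\<^sub>0 = F0 (u i)"
      using limit_factor[OF lim0 internal_category.X0_in_Ob[OF U] functor_betweenD(3)[OF u] u_eq0]
      by blast
    obtain h\<^sub>1 where h\<^sub>1: "h\<^sub>1 \<in> Hom \<E> (X1 U) (X1 L)"
      and h\<^sub>1_eq: "\<And>i. i \<in> Ob J \<Longrightarrow> F1 (l i) \<cdot> h\<^sub>1 = F1 (u i)"
      using limit_factor[OF lim1 internal_category.X1_in_Ob[OF U] functor_betweenD(4)[OF u] u_eq1]
      by blast
    let ?h = "\<lparr>fdom = U, fcod = L, F0 = h\<^sub>0, F1 = h\<^sub>1\<rparr>"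
    have h: "functor_between \<E> U L ?h"
      using functor_lift[OF U L l u mono h\<^sub>0 h\<^sub>1 h\<^sub>0_eq h\<^sub>1_eq] by blast
    show ?thesis
    proof (rule ex1I[of _ ?h], intro conjI ballI)
      show "?h \<in> Hom (full_Cat \<E> P) U L" using h \<open>P U\<close> \<open>P L\<close> by (simp add: Hom_full_Cat)
      fix i assume i: "i \<in> Ob J"
      show "l i \<cdot>\<^bsub>full_Cat \<E> P\<^esub> ?h = u i"
        using h\<^sub>0_eq[OF i] h\<^sub>1_eq[OF i] l[OF i] u[OF i] by (cases "u i") (simp add: functor_between_def)
    next
      fix k assume k: "k \<in> Hom (full_Cat \<E> P) U L \<and> (\<forall>i\<in>Ob J. l i \<cdot>\<^bsub>full_Cat \<E> P\<^esub> k = u i)"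
      then have k': "functor_between \<E> U L k" by (simp add: Hom_full_Cat)
      have k_eq: "F0 (l i) \<cdot> F0 k = F0 (u i)" "F1 (l i) \<cdot> F1 k = F1 (u i)" if "i \<in> Ob J" for i
      proof -
        have "u i = l i \<cdot>\<^bsub>full_Cat \<E> P\<^esub> k" using k that by simp
        then show "F0 (l i) \<cdot> F0 k = F0 (u i)" "F1 (l i) \<cdot> F1 k = F1 (u i)" by simp_all
      qed
      have "F0 k = h\<^sub>0"
        using jointly_monicD[OF mono(1) functor_betweenD(3)[OF k'] h\<^sub>0] k_eq h\<^sub>0_eq by simp
      moreover have "F1 k = h\<^sub>1"
        using jointly_monicD[OF mono(2) functor_betweenD(4)[OF k'] h\<^sub>1] k_eq h\<^sub>1_eq by simp
      ultimately show "k = ?h" using functor_between_eqI[OF k' h] by simp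
    qed
  qed
  ultimately show ?thesis by (simp add: is_limit_def)
qed

text \<open>The level limits are kept in the conclusion: the first conjunct gives finite
  completeness, and all three together, for the kite, give the simultaneous preservation demanded of
  the level functors.\<close>

lemma limit_exists:
  fixes J :: "(nat, nat) cat"
  assumes J: "category J" "finite (Ob J)" "finite (Mor J)"
    and D: "cat_functor J (full_Cat \<E> P) D\<^sub>0 D\<^sub>1"
  shows "\<exists>L l. is_limit J (full_Cat \<E> P) D\<^sub>0 D\<^sub>1 L l \<and>
    is_limit J \<E> (\<lambda>i. X0 (D\<^sub>0 i)) (\<lambda>a. F0 (D\<^sub>1 a)) (X0 L) (\<lambda>i. F0 (l i)) \<and>
    is_limit J \<E> (\<lambda>i. X1 (D\<^sub>0 i)) (\<lambda>a. F1 (D\<^sub>1 a)) (X1 L) (\<lambda>i. F1 (l i))"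
proof -
  interpret internal_diagram \<E> J D\<^sub>0 D\<^sub>1 using internal_diagram_full_Cat[OF J(1) D] .
  have "\<exists>L l. is_limit J \<E> (\<lambda>i. X0 (D\<^sub>0 i)) (\<lambda>a. F0 (D\<^sub>1 a)) L l"
    "\<exists>L l. is_limit J \<E> (\<lambda>i. X1 (D\<^sub>0 i)) (\<lambda>a. F1 (D\<^sub>1 a)) L l"
    using finitely_complete J level0 level1 unfolding finitely_complete_def by blast+
  then obtain L l where lim: "levelwise_limit L l" using levelwise_limit_exists by blast
  have "P L"
    by (rule P_levelwise_limit[OF internal_diagram_axioms lim]) (use D in \<open>simp add: cat_functor_def\<close>)
  from levelwise_limit_is_limit[OF J(1) D lim this] lim show ?thesis
    by (intro exI[of _ L] exI[of _ l]) (simp add: levelwise_limit_def)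
qed

text \<open>The family is indexed by the truth values: \<open>False\<close> is the level of objects
  and \<open>True\<close> the level of arrows.\<close>

sublocale relation_reflecting_family "full_Cat \<E> P" \<E>
  "\<lambda>n X. if n then X1 X else X0 X" "\<lambda>n F. if n then F1 F else F0 F"
proof
  fix n
  show "cat_functor (full_Cat \<E> P) \<E> (\<lambda>X. if n then X1 X else X0 X) (\<lambda>F. if n then F1 F else F0 F)"
    using cat_functor_level0 cat_functor_level1 by (cases n) simp_all
next
  fix D\<^sub>0 D\<^sub>1 assume "cat_functor kite (full_Cat \<E> P) D\<^sub>0 D\<^sub>1"
  from limit_exists[OF category_kite finite_kite this] obtain L l where
    "is_limit kite (full_Cat \<E> P) D\<^sub>0 D\<^sub>1 L l"
    "is_limit kite \<E> (\<lambda>i. X0 (D\<^sub>0 i)) (\<lambda>a. F0 (D\<^sub>1 a)) (X0 L) (\<lambda>i. F0 (l i))"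
    "is_limit kite \<E> (\<lambda>i. X1 (D\<^sub>0 i)) (\<lambda>a. F1 (D\<^sub>1 a)) (X1 L) (\<lambda>i. F1 (l i))" by blast
  then show "\<exists>L l. is_limit kite (full_Cat \<E> P) D\<^sub>0 D\<^sub>1 L l \<and>
      (\<forall>n. is_limit kite \<E> (\<lambda>i. if n then X1 (D\<^sub>0 i) else X0 (D\<^sub>0 i))
        (\<lambda>a. if n then F1 (D\<^sub>1 a) else F0 (D\<^sub>1 a))
        (if n then X1 L else X0 L) (\<lambda>i. if n then F1 (l i) else F0 (l i)))"
    by (intro exI[of _ L] exI[of _ l]) (simp add: all_bool_eq)
next
  fix t\<^sub>0 t\<^sub>1 x y A X U
  assume "t\<^sub>0 \<in> Hom (full_Cat \<E> P) A X" "t\<^sub>1 \<in> Hom (full_Cat \<E> P) A X"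
    "x \<in> Hom (full_Cat \<E> P) U X" "y \<in> Hom (full_Cat \<E> P) U X"
    and rel: "\<And>n. is_relation \<E> (if n then X1 X else X0 X)
      (if n then F1 t\<^sub>0 else F0 t\<^sub>0, if n then F1 t\<^sub>1 else F0 t\<^sub>1)"
    and holds: "\<And>n. rel_holds \<E> (if n then F1 t\<^sub>0 else F0 t\<^sub>0, if n then F1 t\<^sub>1 else F0 t\<^sub>1)
      (if n then F1 x else F0 x) (if n then F1 y else F0 y)"
  then have t: "functor_between \<E> A X t\<^sub>0" "functor_between \<E> A X t\<^sub>1"
    and xy: "functor_between \<E> U X x" "functor_between \<E> U X y" and P: "P A" "P U"
    by (simp_all add: Hom_full_Cat)
  note t\<^sub>0 = functor_betweenD[OF t(1)] and t\<^sub>1 = functor_betweenD[OF t(2)]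
  note x = functor_betweenD[OF xy(1)]
  \<comment> \<open>The two legs of a relation as a family over the truth values, in the form
    \<open>functor_lift\<close> expects.\<close>
  have mono: "jointly_monic \<E> UNIV K (\<lambda>b. if b then m\<^sub>0 else m\<^sub>1)"
    if R: "is_relation \<E> Y (m\<^sub>0, m\<^sub>1)" and m: "m\<^sub>0 \<in> Hom \<E> K Y" for K Y m\<^sub>0 m\<^sub>1
  proof -
    obtain K' where K': "m\<^sub>0 \<in> Hom \<E> K' Y" "m\<^sub>1 \<in> Hom \<E> K' Y" and mono: "\<And>V u v. u \<in> Hom \<E> V K' \<Longrightarrow>
        v \<in> Hom \<E> V K' \<Longrightarrow> m\<^sub>0 \<cdot> u = m\<^sub>0 \<cdot> v \<Longrightarrow> m\<^sub>1 \<cdot> u = m\<^sub>1 \<cdot> v \<Longrightarrow> u = v"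
      using relationE[OF R] by blast
    have "K' = K" using K'(1) m by (simp add: Hom_def)
    then show ?thesis using mono unfolding jointly_monic_def by (simp add: all_bool_eq)
  qed
  obtain h\<^sub>0 where h\<^sub>0: "h\<^sub>0 \<in> Hom \<E> (X0 U) (X0 A)" "F0 t\<^sub>0 \<cdot> h\<^sub>0 = F0 x" "F0 t\<^sub>1 \<cdot> h\<^sub>0 = F0 y"
    using holds[of False] rel_holds_iff[OF t\<^sub>0(3) x(3)] by auto
  obtain h\<^sub>1 where h\<^sub>1: "h\<^sub>1 \<in> Hom \<E> (X1 U) (X1 A)" "F1 t\<^sub>0 \<cdot> h\<^sub>1 = F1 x" "F1 t\<^sub>1 \<cdot> h\<^sub>1 = F1 y"
    using holds[of True] rel_holds_iff[OF t\<^sub>0(4) x(4)] by auto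
  let ?h = "\<lparr>fdom = U, fcod = A, F0 = h\<^sub>0, F1 = h\<^sub>1\<rparr>"
  \<comment> \<open>The legs \<open>t\<^sub>0\<close> and \<open>t\<^sub>1\<close> play the part of
    limit projections into the constant family \<open>X\<close>, and \<open>x\<close>,
    \<open>y\<close> that of the cone to be lifted.\<close>
  have "functor_between \<E> U A ?h"
  proof (rule functor_lift[where I = UNIV and D = "\<lambda>_. X"
        and l = "\<lambda>b. if b then t\<^sub>0 else t\<^sub>1" and u = "\<lambda>b. if b then x else y"])
    show "internal_category \<E> U" "internal_category \<E> A" using x t\<^sub>0 by blast+
    show "jointly_monic \<E> UNIV (X0 A) (\<lambda>b. F0 (if b then t\<^sub>0 else t\<^sub>1))"
      using mono[OF _ t\<^sub>0(3)] rel[of False] by (simp add: if_distrib)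
    show "jointly_monic \<E> UNIV (X1 A) (\<lambda>b. F1 (if b then t\<^sub>0 else t\<^sub>1))"
      using mono[OF _ t\<^sub>0(4)] rel[of True] by (simp add: if_distrib)
  qed (use t xy h\<^sub>0 h\<^sub>1 in simp_all)
  then have "?h \<in> Hom (full_Cat \<E> P) U A" using P by (simp add: Hom_full_Cat)
  moreover have "t\<^sub>0 \<cdot>\<^bsub>full_Cat \<E> P\<^esub> ?h = x" "t\<^sub>1 \<cdot>\<^bsub>full_Cat \<E> P\<^esub> ?h = y"
    using h\<^sub>0 h\<^sub>1 t xy by (cases x; cases y; simp add: functor_between_def)+
  ultimately show "rel_holds (full_Cat \<E> P) (t\<^sub>0, t\<^sub>1) x y"
    using full.rel_holds_iff[of t\<^sub>0 A X x U t\<^sub>1 y] t xy P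
      \<open>t\<^sub>0 \<in> Hom (full_Cat \<E> P) A X\<close> \<open>x \<in> Hom (full_Cat \<E> P) U X\<close> by blast
qed

lemma gumm_category_full_Cat:
  assumes "gumm_category \<E>"
  shows "gumm_category (full_Cat \<E> P)"
  unfolding gumm_category_def
proof (intro conjI)
  show "category (full_Cat \<E> P)" by (fact category_full_Cat)
  show "finitely_complete (full_Cat \<E> P)"
    using limit_exists unfolding finitely_complete_def by blast
  show "shifting_lemma (full_Cat \<E> P)"
    using shifting_lemma_transfer assms by (simp add: gumm_category_def)
qed

end

theorem proposition4p9:
  fixes \<E> :: "('o, 'm) cat"
  assumes "gumm_category \<E>"
  shows "gumm_category (Grd \<E>) \<and> gumm_category (Cat \<E>)"
proof -
  interpret lex_category \<E>
    using assms by (simp add: gumm_category_def lex_category_def lex_category_axioms_def)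
  \<comment> \<open>Closure is immediate here, since a levelwise limit is an internal category by
    definition; for groupoids it rests on the induced inversion.\<close>
  interpret Cat: internal_full_subcategory \<E> "internal_category \<E>"
    by (intro internal_full_subcategory.intro internal_full_subcategory_axioms.intro)
      (fact lex_category_axioms, auto simp: internal_diagram.levelwise_limit_def)
  interpret Grd: internal_full_subcategory \<E> "internal_groupoid \<E>"
    by (intro internal_full_subcategory.intro internal_full_subcategory_axioms.intro)
      (fact lex_category_axioms, simp add: internal_groupoid_iff,
        rule internal_diagram.levelwise_limit_groupoid)
  show ?thesis
    using Cat.gumm_category_full_Cat[OF assms] Grd.gumm_category_full_Cat[OF assms]
    by (simp add: Cat_eq_full_Cat Grd_eq_full_Cat)
qed

end
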